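(* Let $w\in L^1(\mathbb{R}^d)\cap L^\infty(\mathbb{R}^d)$ with $w\neq0$ and $w\ge0$ almost everywhere, and let $k(x,y):=\widehat{w}(x-y)$. Assume: (A) for any $a>0$ there exists $c_a>0$ such that $w(\xi)\le c_ae^{-a|\xi|}$ for almost all $\xi\in\mathbb{R}^d$; (B) there exists $B>0$ such that for any $y\in\mathbb{R}^d$, $\limsup_{n\to\infty}\mathcal{E}_n^-(y;w)<B$ and $\limsup_{n\to\infty}\mathcal{E}_n^+(y;w)<B$; (C) $\mathcal{G}(w)$ spans ${\rm M}_d(\mathbb{R})$ as a real vector space. Then for any nonempty open set $U\subset\mathbb{R}^d$ and any map $f:U\to\mathbb{R}^d$ with $\mathcal{D}(C_f)=H_k$, the composition operator $C_f:H_k\to H_{k|_{U^2}}$ is not compact.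
   Context: Fourier transform: $\widehat{h}(\xi)=\int_{\mathbb{R}^d}h(x)e^{-2\pi i x\cdot\xi}\,dx$. For a positive definite kernel $k$ on a set $E$, $H_k\subset\mathbb{C}^E$ is the reproducing kernel Hilbert space (RKHS) of $k$: $k_x:=k(x,\cdot)\in H_k$ and $\langle h,k_x\rangle_{H_k}=h(x)$. For $U\subset\mathbb{R}^d$, $H_{k|_{U^2}}\subset\mathbb{C}^U$ is the RKHS of the restriction of $k$ to $U\times U$. For $f:U\to\mathbb{R}^d$, the composition operator $C_f:H_k\to H_{k|_{U^2}}$ is $C_fh=h\circ f$ with domain $\mathcal{D}(C_f)=\{h\in H_k:h\circ f\in H_{k|_{U^2}}\}$. $L^2(w)$ is the $L^2$-space for the measure $w(\xi)\,d\xi$. $P_n\subset\mathbb{C}[\xi_1,\dots,\xi_d]$ is the space of polynomials of total degree at most $n$, regarded as a subspace of $L^2(w)$. For $y\in\mathbb{R}^d$, $(m_yh)(\xi)=e^{y^\top\xi}h(\xi)$. Define $$\mathcal{E}_n^+(y;w)=\Big(\sup_{P\in P_n\setminus\{0\}}\frac{\|m_yP\|_{L^2(w)}}{\|P\|_{L^2(w)}}\Big)^{1/n},\qquad \mathcal{E}_n^-(y;w)=\Big(\sup_{P\in P_n\setminus\{0\}}\frac{\|P\|_{L^2(w)}}{\|m_yP\|_{L^2(w)}}\Big)^{1/n}.$$ $\mathcal{G}(w)$ is the set of $A\in{\rm GL}_d(\mathbb{R})$ such that for some $\lambda>0$, $w(A^\top\xi)\ge\lambda w(\xi)$ for almost every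 $\xi\in\mathbb{R}^d$. *)

theory Defs
  imports "HOL-Analysis.Analysis"
begin

section \<open>Reproducing kernel Hilbert spaces\<close>

text \<open>
  The space of complex functions on a set \<open>E\<close> is encoded as the set of total functions that
  vanish outside \<open>E\<close>; this is a linear subspace for the pointwise operations.  The inner product
  \<open>ip\<close> is linear in its first argument, and its values outside the carrier \<open>H\<close> are irrelevant.
\<close>

locale function_inner_product_space =
  fixes E :: "'a set"
    and H :: "('a \<Rightarrow> complex) set"
    and ip :: "('a \<Rightarrow> complex) \<Rightarrow> ('a \<Rightarrow> complex) \<Rightarrow> complex"
  assumes support: "h \<in> H \<Longrightarrow> x \<notin> E \<Longrightarrow> h x = 0"
    and zero_closed: "(\<lambda>x. 0) \<in> H"
    and add_closed: "g \<in> H \<Longrightarrow> h \<in> H \<Longrightarrow> (\<lambda>x. g x + h x) \<in> H"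
    and scale_closed: "h \<in> H \<Longrightarrow> (\<lambda>x. c * h x) \<in> H"
    and ip_add: "f \<in> H \<Longrightarrow> g \<in> H \<Longrightarrow> h \<in> H \<Longrightarrow> ip (\<lambda>x. f x + g x) h = ip f h + ip g h"
    and ip_scale: "g \<in> H \<Longrightarrow> h \<in> H \<Longrightarrow> ip (\<lambda>x. c * g x) h = c * ip g h"
    and ip_commute: "g \<in> H \<Longrightarrow> h \<in> H \<Longrightarrow> ip h g = cnj (ip g h)"
    and ip_nonneg: "h \<in> H \<Longrightarrow> 0 \<le> Re (ip h h)"
    and ip_definite: "h \<in> H \<Longrightarrow> ip h h = 0 \<Longrightarrow> h = (\<lambda>x. 0)"

text \<open>
  The distance is set to \<open>0\<close> off the carrier because the locale \<^locale>\<open>Metric_space\<close> requires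
  nonnegativity and symmetry for all arguments.
\<close>

definition ip_dist ::
  "('a \<Rightarrow> complex) set \<Rightarrow> (('a \<Rightarrow> complex) \<Rightarrow> ('a \<Rightarrow> complex) \<Rightarrow> complex)
    \<Rightarrow> ('a \<Rightarrow> complex) \<Rightarrow> ('a \<Rightarrow> complex) \<Rightarrow> real" where
  "ip_dist H ip g h =
    (if g \<in> H \<and> h \<in> H then sqrt (Re (ip (\<lambda>x. g x - h x) (\<lambda>x. g x - h x))) else 0)"

context function_inner_product_space
begin

lemma diff_closed:
  assumes "g \<in> H" "h \<in> H"
  shows "(\<lambda>x. g x - h x) \<in> H"
  using add_closed[OF assms(1) scale_closed[OF assms(2), of "-1"]] by simp

lemma ip_add_right:
  assumes "f \<in> H" "g \<in> H" "h \<in> H"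
  shows "ip h (\<lambda>x. f x + g x) = ip h f + ip h g"
  using ip_commute[OF add_closed[OF assms(1,2)] assms(3)] ip_add[OF assms]
    ip_commute[OF assms(1,3)] ip_commute[OF assms(2,3)]
  by simp

lemma ip_scale_right:
  assumes "g \<in> H" "h \<in> H"
  shows "ip h (\<lambda>x. c * g x) = cnj c * ip h g"
  using ip_commute[OF scale_closed[OF assms(1)] assms(2), of c] ip_scale[OF assms, of c]
    ip_commute[OF assms]
  by simp

lemma ip_self_real: "h \<in> H \<Longrightarrow> Im (ip h h) = 0"
  using ip_commute[of h h] by (simp add: complex_eq_iff)

lemma ip_self_zero_iff: "h \<in> H \<Longrightarrow> Re (ip h h) = 0 \<longleftrightarrow> h = (\<lambda>x. 0)"
proof -
  assume h: "h \<in> H"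
  have "ip (\<lambda>x. 0) (\<lambda>x. 0) = 0"
    using ip_scale[OF zero_closed zero_closed, of 0] by simp
  moreover have "ip h h = 0" if "Re (ip h h) = 0"
    using that ip_self_real[OF h] by (simp add: complex_eq_iff)
  ultimately show ?thesis
    using ip_definite[OF h] by auto
qed

lemma Re_ip_add_scale:
  assumes "g \<in> H" "h \<in> H"
  shows "Re (ip (\<lambda>x. g x + of_real t * h x) (\<lambda>x. g x + of_real t * h x))
    = Re (ip g g) + 2 * t * Re (ip g h) + t\<^sup>2 * Re (ip h h)"
proof -
  have "(\<lambda>x. of_real t * h x) \<in> H" "(\<lambda>x. g x + of_real t * h x) \<in> H"
    using assms by (auto intro: scale_closed add_closed)
  moreover have "Re (ip h g) = Re (ip g h)"
    using ip_commute[OF assms] by simp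
  ultimately show ?thesis
    using assms
    by (simp add: ip_add ip_add_right ip_scale ip_scale_right power2_eq_square algebra_simps)
qed

lemma Re_Cauchy_Schwarz:
  assumes "g \<in> H" "h \<in> H"
  shows "Re (ip g h) \<le> sqrt (Re (ip g g)) * sqrt (Re (ip h h))"
proof (cases "Re (ip h h) = 0")
  case True
  then have "h = (\<lambda>x. 0)"
    using ip_self_zero_iff[OF assms(2)] by simp
  then have "ip g h = 0"
    using ip_scale_right[OF assms(2,1), of 0] by simp
  then show ?thesis using True by simp
next
  case False
  then have pos: "0 < Re (ip h h)"
    using ip_nonneg[OF assms(2)] by simp
  define t where "t = - Re (ip g h) / Re (ip h h)"
  have "(\<lambda>x. g x + of_real t * h x) \<in> H"
    using assms by (auto intro: scale_closed add_closed)
  from ip_nonneg[OF this]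
  have "0 \<le> Re (ip g g) + 2 * t * Re (ip g h) + t\<^sup>2 * Re (ip h h)"
    using Re_ip_add_scale[OF assms] by simp
  also have "\<dots> = Re (ip g g) - (Re (ip g h))\<^sup>2 / Re (ip h h)"
    using pos by (simp add: t_def field_simps power2_eq_square)
  finally have "(Re (ip g h))\<^sup>2 \<le> Re (ip g g) * Re (ip h h)"
    using pos by (simp add: field_simps)
  then have "Re (ip g h) \<le> sqrt (Re (ip g g) * Re (ip h h))"
    by (rule real_le_rsqrt)
  then show ?thesis by (simp add: real_sqrt_mult)
qed

lemma norm_triangle:
  assumes "g \<in> H" "h \<in> H"
  shows "sqrt (Re (ip (\<lambda>x. g x + h x) (\<lambda>x. g x + h x)))
    \<le> sqrt (Re (ip g g)) + sqrt (Re (ip h h))"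
proof (rule real_le_lsqrt)
  show "0 \<le> sqrt (Re (ip g g)) + sqrt (Re (ip h h))"
    using assms by (simp add: ip_nonneg)
  show "Re (ip (\<lambda>x. g x + h x) (\<lambda>x. g x + h x))
    \<le> (sqrt (Re (ip g g)) + sqrt (Re (ip h h)))\<^sup>2"
    using Re_ip_add_scale[OF assms, of 1] Re_Cauchy_Schwarz[OF assms]
      ip_nonneg[OF assms(1)] ip_nonneg[OF assms(2)]
    by (simp add: power2_sum)
qed

sublocale Metric_space H "ip_dist H ip"
proof
  fix f g h :: "'a \<Rightarrow> complex"
  show "0 \<le> ip_dist H ip f g"
    by (auto simp: ip_dist_def intro: ip_nonneg diff_closed)
  show "ip_dist H ip f g = ip_dist H ip g f"
  proof (cases "f \<in> H \<and> g \<in> H")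
    case True
    let ?u = "\<lambda>x. f x - g x"
    have "?u \<in> H" using True by (auto intro: diff_closed)
    then have "ip (\<lambda>x. - 1 * ?u x) (\<lambda>x. - 1 * ?u x) = ip ?u ?u"
      using ip_scale[of ?u "\<lambda>x. - 1 * ?u x" "- 1"] ip_scale_right[of ?u ?u "- 1"]
        scale_closed[of ?u "- 1"]
      by simp
    then show ?thesis using True by (simp add: ip_dist_def)
  qed (auto simp: ip_dist_def)
  assume fg: "f \<in> H" "g \<in> H"
  show "ip_dist H ip f g = 0 \<longleftrightarrow> f = g"
    using fg ip_self_zero_iff[OF diff_closed[OF fg]] by (auto simp: ip_dist_def fun_eq_iff)
  assume h: "h \<in> H"
  show "ip_dist H ip f h \<le> ip_dist H ip f g + ip_dist H ip g h"
    using norm_triangle[OF diff_closed[OF fg] diff_closed[OF fg(2) h]] fg h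
    by (simp add: ip_dist_def)
qed

end

text \<open>
  \<open>rkhs E k H ip\<close> says that \<open>H\<close> with inner product \<open>ip\<close> is the reproducing kernel Hilbert
  space of the restriction of \<open>k\<close> to \<open>E \<times> E\<close>: only values of \<open>k\<close> on \<open>E \<times> E\<close> are used, and
  \<open>kernel_section E k x\<close> is the function \<open>k x\<close> on \<open>E\<close> (extended by \<open>0\<close>).  By the
  Moore--Aronszajn theorem such \<open>H\<close> and \<open>ip\<close> exist, and are unique, precisely when this
  restriction is a positive definite kernel.
\<close>

definition kernel_section :: "'a set \<Rightarrow> ('a \<Rightarrow> 'a \<Rightarrow> complex) \<Rightarrow> 'a \<Rightarrow> 'a \<Rightarrow> complex" where
  "kernel_section E k x = (\<lambda>y. if y \<in> E then k x y else 0)"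

locale rkhs = function_inner_product_space E H ip
  for E :: "'a set" and k :: "'a \<Rightarrow> 'a \<Rightarrow> complex" and H and ip +
  assumes complete: "Metric_space.mcomplete H (ip_dist H ip)"
    and section_in: "x \<in> E \<Longrightarrow> kernel_section E k x \<in> H"
    and reproducing: "h \<in> H \<Longrightarrow> x \<in> E \<Longrightarrow> ip h (kernel_section E k x) = h x"


section \<open>Composition operators and compactness\<close>

definition composition_operator ::
  "'a set \<Rightarrow> ('a \<Rightarrow> 'b) \<Rightarrow> ('b \<Rightarrow> complex) \<Rightarrow> 'a \<Rightarrow> complex" where
  "composition_operator U f h = (\<lambda>x. if x \<in> U then h (f x) else 0)"

definition composition_domain ::
  "'a set \<Rightarrow> ('a \<Rightarrow> 'b) \<Rightarrow> ('b \<Rightarrow> complex) set \<Rightarrow> ('a \<Rightarrow> complex) set \<Rightarrow> ('b \<Rightarrow> complex) set" where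
  "composition_domain U f H H' = {h \<in> H. composition_operator U f h \<in> H'}"

definition compact_operator ::
  "('b \<Rightarrow> complex) set \<Rightarrow> (('b \<Rightarrow> complex) \<Rightarrow> ('b \<Rightarrow> complex) \<Rightarrow> complex) \<Rightarrow>
   ('a \<Rightarrow> complex) set \<Rightarrow> (('a \<Rightarrow> complex) \<Rightarrow> ('a \<Rightarrow> complex) \<Rightarrow> complex) \<Rightarrow>
   (('b \<Rightarrow> complex) \<Rightarrow> ('a \<Rightarrow> complex)) \<Rightarrow> bool" where
  "compact_operator H ip H' ip' T \<longleftrightarrow>
    T ` H \<subseteq> H' \<and>
    (\<forall>S. Metric_space.mbounded H (ip_dist H ip) S \<longrightarrow>
      compactin (Metric_space.mtopology H' (ip_dist H' ip'))
        (Metric_space.mtopology H' (ip_dist H' ip') closure_of (T ` S)))"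


section \<open>Fourier transform and weighted polynomial spaces\<close>

definition fourier :: "(real^'d \<Rightarrow> complex) \<Rightarrow> real^'d \<Rightarrow> complex" where
  "fourier h \<xi> = (LINT x|lebesgue. h x * exp (- 2 * of_real pi * \<i> * of_real (x \<bullet> \<xi>)))"

definition weighted_L2_norm :: "(real^'d \<Rightarrow> real) \<Rightarrow> (real^'d \<Rightarrow> complex) \<Rightarrow> real" where
  "weighted_L2_norm w h =
    sqrt (LINT \<xi>|density lebesgue (\<lambda>\<xi>. ennreal (w \<xi>)). (cmod (h \<xi>))\<^sup>2)"

text \<open>Complex polynomial functions of total degree at most \<open>n\<close>; the maps \<open>\<alpha>\<close> are multi-indices.\<close>

definition polys_upto :: "nat \<Rightarrow> (real^'d \<Rightarrow> complex) set" where
  "polys_upto n =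
    {P. \<exists>c :: ('d \<Rightarrow> nat) \<Rightarrow> complex.
      P = (\<lambda>\<xi>. \<Sum>\<alpha> | (\<Sum>i\<in>UNIV. \<alpha> i) \<le> n. c \<alpha> * (\<Prod>i\<in>UNIV. of_real (\<xi> $ i) ^ \<alpha> i))}"

definition exp_mult :: "real^'d \<Rightarrow> (real^'d \<Rightarrow> complex) \<Rightarrow> real^'d \<Rightarrow> complex" where
  "exp_mult y h = (\<lambda>\<xi>. of_real (exp (y \<bullet> \<xi>)) * h \<xi>)"

text \<open>
  For nonnegative \<open>w\<close> that decays faster than every exponential and is not a.e. zero, the norms
  below are finite and nonzero, and the suprema are finite since the polynomial space is
  finite-dimensional.  The value for \<open>n = 0\<close> is immaterial for the limit superior.
\<close>

definition growth_plus :: "nat \<Rightarrow> real^'d \<Rightarrow> (real^'d \<Rightarrow> real) \<Rightarrow> real" where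
  "growth_plus n y w =
    root n (SUP P \<in> polys_upto n - {\<lambda>\<xi>. 0}.
      weighted_L2_norm w (exp_mult y P) / weighted_L2_norm w P)"

definition growth_minus :: "nat \<Rightarrow> real^'d \<Rightarrow> (real^'d \<Rightarrow> real) \<Rightarrow> real" where
  "growth_minus n y w =
    root n (SUP P \<in> polys_upto n - {\<lambda>\<xi>. 0}.
      weighted_L2_norm w P / weighted_L2_norm w (exp_mult y P))"

definition weight_linear_maps :: "(real^'d \<Rightarrow> real) \<Rightarrow> (real^'d^'d) set" where
  "weight_linear_maps w =
    {A. invertible A \<and>
      (\<exists>r>0. AE \<xi> in lebesgue. w (transpose A *v \<xi>) \<ge> r * w \<xi>)}"

end

theory Submission
  imports Defs "HOL-Complex_Analysis.Conformal_Mappings" "HOL-Real_Asymp.Real_Asymp"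
begin

text \<open>
  Suppose that \<open>T\<close>, the composition operator of \<open>f\<close>, is compact.  Its adjoint maps the kernel section
  \<open>k x\<close> of a point \<open>x \<in> U\<close> to \<open>k (f x)\<close>, and since \<open>k x y\<close> depends only on \<open>x - y\<close>, all
  kernel sections have the same norm, whose square \<open>\<kappa>\<close> is the integral of \<open>w\<close>.  The idea is to follow
  \<open>T* (k x)\<close> analytically as \<open>x\<close> runs along a whole line that starts in \<open>U\<close>.

  On the Fourier side \<open>k x\<close> is the character \<open>\<xi> \<mapsto> exp (- 2 \<pi> \<i> x \<bullet> \<xi>)\<close> in \<open>L\<^sup>2\<close> of the measure
  \<open>w d\<xi>\<close>.  Because \<open>w\<close> decays faster than every exponential, the character of \<open>p + z v\<close> is an entire
  \<open>L\<^sup>2\<close>-valued function of \<open>z\<close>, and for every complex \<open>z\<close> it is a limit of combinations of the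
  characters of points of the segment from \<open>p\<close> to \<open>p + v\<close>, which lies in \<open>U\<close>.  Hence
  \<open>\<Phi> z = T* (k (p + z v))\<close> makes sense and is entire.  The entire function
  \<open>z \<mapsto> \<langle>\<Phi> z, \<Phi> (cnj z)\<rangle>\<close> equals \<open>\<kappa>\<close> on \<open>[0, 1]\<close>, where \<open>\<Phi> t\<close> is a kernel section, so
  it equals \<open>\<kappa>\<close> everywhere and \<open>\<Phi> t\<close> has norm \<open>sqrt \<kappa>\<close> for all real \<open>t\<close>.  But
  the vectors \<open>k (p + t v)\<close> tend weakly to \<open>0\<close> for \<open>t \<rightarrow> \<infinity>\<close> by the Riemann--Lebesgue lemma, so
  compactness forces \<open>\<Phi> t \<rightarrow> 0\<close>.  As \<open>\<kappa> > 0\<close>, this is a contradiction.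

  The limits \<open>\<Phi> z\<close> are never formed.  They are replaced by Bernstein polynomials of the curve
  \<open>t \<mapsto> k (p + t v)\<close>, which are finite combinations of kernel sections of points of \<open>U\<close> with
  coefficients polynomial in \<open>z\<close>; up to the character of \<open>p\<close> their Fourier side is
  \<open>(1 + z (q - 1))\<^sup>m\<close> with \<open>q\<close> unimodular, which converges to the exponential with an explicit
  error (\<open>bernstein_exp_error\<close>).  The continuation argument is \<open>energy_limit\<close>, the role of compactness
  is \<open>compact_operator_weakly_null_pairing\<close>, weak convergence is reduced to combinations of
  kernel sections by \<open>weakly_null_of_subspace\<close>, and \<open>not_compact\<close> combines them.
\<close>

section \<open>Inner product spaces of functions\<close>

text \<open>
  A list of coefficients and points is a formal linear combination of points.  The same list is
  evaluated in three families: kernel sections at the points, kernel sections at their images under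
  \<open>f\<close>, and characters.
\<close>

definition lin_comb :: "('p \<Rightarrow> 'a \<Rightarrow> complex) \<Rightarrow> (complex \<times> 'p) list \<Rightarrow> 'a \<Rightarrow> complex" where
  "lin_comb \<Phi> ps = (\<lambda>y. \<Sum>(c, x)\<leftarrow>ps. c * \<Phi> x y)"

definition scale_comb :: "complex \<Rightarrow> (complex \<times> 'p) list \<Rightarrow> (complex \<times> 'p) list" where
  "scale_comb a ps = map (\<lambda>(c, x). (a * c, x)) ps"

definition diff_comb :: "(complex \<times> 'p) list \<Rightarrow> (complex \<times> 'p) list \<Rightarrow> (complex \<times> 'p) list" where
  "diff_comb ps qs = ps @ scale_comb (- 1) qs"

lemma lin_comb_Nil: "lin_comb \<Phi> [] = (\<lambda>y. 0)"
  by (simp add: lin_comb_def)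

lemma lin_comb_Cons: "lin_comb \<Phi> ((c, x) # ps) = (\<lambda>y. c * \<Phi> x y + lin_comb \<Phi> ps y)"
  by (simp add: lin_comb_def)

lemma lin_comb_append: "lin_comb \<Phi> (ps @ qs) = (\<lambda>y. lin_comb \<Phi> ps y + lin_comb \<Phi> qs y)"
  by (simp add: lin_comb_def)

lemma lin_comb_scale: "lin_comb \<Phi> (scale_comb a ps) = (\<lambda>y. a * lin_comb \<Phi> ps y)"
  by (induction ps)
    (auto simp: scale_comb_def lin_comb_Nil lin_comb_Cons fun_eq_iff algebra_simps)

lemma lin_comb_diff:
  "lin_comb \<Phi> (diff_comb ps qs) = (\<lambda>y. lin_comb \<Phi> ps y - lin_comb \<Phi> qs y)"
  by (simp add: diff_comb_def lin_comb_append lin_comb_scale)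

lemma points_scale_comb [simp]: "snd ` set (scale_comb a ps) = snd ` set ps"
  by (force simp: scale_comb_def)

lemma points_diff_comb [simp]: "snd ` set (diff_comb ps qs) = snd ` set ps \<union> snd ` set qs"
  by (simp add: diff_comb_def image_Un)

lemma lin_comb_single: "lin_comb \<Phi> [(1, x)] = \<Phi> x"
  by (simp add: lin_comb_def)

definition ip_norm :: "(('a \<Rightarrow> complex) \<Rightarrow> ('a \<Rightarrow> complex) \<Rightarrow> complex) \<Rightarrow> ('a \<Rightarrow> complex) \<Rightarrow> real" where
  "ip_norm ip h = sqrt (Re (ip h h))"

context function_inner_product_space
begin

lemma ip_norm_nonneg: "h \<in> H \<Longrightarrow> 0 \<le> ip_norm ip h"
  by (simp add: ip_norm_def ip_nonneg)

lemma ip_self: "h \<in> H \<Longrightarrow> ip h h = of_real ((ip_norm ip h)\<^sup>2)"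
  by (simp add: ip_norm_def ip_nonneg ip_self_real complex_eq_iff)

lemma ip_zero_left: "g \<in> H \<Longrightarrow> ip (\<lambda>x. 0) g = 0"
  using ip_scale[of g g 0] by simp

lemma ip_zero_right: "g \<in> H \<Longrightarrow> ip g (\<lambda>x. 0) = 0"
  using ip_scale_right[of g g 0] by simp

lemma ip_diff_left:
  assumes "f \<in> H" "g \<in> H" "h \<in> H"
  shows "ip (\<lambda>x. f x - g x) h = ip f h - ip g h"
  using ip_add[OF assms(1) scale_closed[OF assms(2), of "-1"] assms(3)] ip_scale[OF assms(2,3), of "-1"]
  by simp

lemma ip_diff_right:
  assumes "f \<in> H" "g \<in> H" "h \<in> H"
  shows "ip h (\<lambda>x. f x - g x) = ip h f - ip h g"
  using ip_add_right[OF assms(1) scale_closed[OF assms(2), of "-1"] assms(3)]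
    ip_scale_right[OF assms(2,3), of "-1"]
  by simp

lemma ip_norm_scale: "h \<in> H \<Longrightarrow> ip_norm ip (\<lambda>x. c * h x) = cmod c * ip_norm ip h"
proof -
  assume h: "h \<in> H"
  then have "ip (\<lambda>x. c * h x) (\<lambda>x. c * h x) = of_real ((cmod c * ip_norm ip h)\<^sup>2)"
    using ip_scale[OF h scale_closed[OF h, of c], of c] ip_scale_right[OF h h, of c] ip_self[OF h]
    by (simp add: power_mult_distrib mult.assoc[symmetric] complex_norm_square
        flip: of_real_power)
  then show ?thesis
    using h by (simp add: ip_norm_def[of ip "\<lambda>x. c * h x"] ip_norm_nonneg)
qed

lemma ip_norm_zero: "ip_norm ip (\<lambda>x. 0) = 0"
  by (simp add: ip_norm_def ip_zero_left zero_closed)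

lemma ip_norm_triangle:
  "g \<in> H \<Longrightarrow> h \<in> H \<Longrightarrow> ip_norm ip (\<lambda>x. g x + h x) \<le> ip_norm ip g + ip_norm ip h"
  unfolding ip_norm_def by (rule norm_triangle)

lemma ip_norm_diff_ge:
  assumes "g \<in> H" "h \<in> H"
  shows "\<bar>ip_norm ip g - ip_norm ip h\<bar> \<le> ip_norm ip (\<lambda>x. g x - h x)"
proof -
  have "ip_norm ip g \<le> ip_norm ip (\<lambda>x. g x - h x) + ip_norm ip h"
    using ip_norm_triangle[OF diff_closed[OF assms] assms(2)] by simp
  moreover have "ip_norm ip h \<le> ip_norm ip (\<lambda>x. h x - g x) + ip_norm ip g"
    using ip_norm_triangle[OF diff_closed[OF assms(2,1)] assms(1)] by simp
  moreover have "ip_norm ip (\<lambda>x. h x - g x) = ip_norm ip (\<lambda>x. g x - h x)"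
    using ip_norm_scale[OF diff_closed[OF assms], of "-1"] by simp
  ultimately show ?thesis by simp
qed

lemma Cauchy_Schwarz:
  assumes "g \<in> H" "h \<in> H"
  shows "cmod (ip g h) \<le> ip_norm ip g * ip_norm ip h"
proof (cases "ip g h = 0")
  case False
  define u where "u = cnj (ip g h) / of_real (cmod (ip g h))"
  have "ip (\<lambda>x. u * g x) h = of_real (cmod (ip g h))"
    using False ip_scale[OF assms, of u]
    by (simp add: u_def divide_simps complex_norm_square[symmetric] power2_eq_square mult.commute)
  moreover have "cmod u = 1" using False by (simp add: u_def norm_divide)
  ultimately show ?thesis
    using Re_Cauchy_Schwarz[OF scale_closed[OF assms(1)] assms(2), of u]
      ip_norm_scale[OF assms(1), of u]
    by (simp add: ip_norm_def)
qed (simp add: assms ip_norm_nonneg)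

lemma lin_comb_closed: "(\<And>x. x \<in> snd ` set ps \<Longrightarrow> \<Phi> x \<in> H) \<Longrightarrow> lin_comb \<Phi> ps \<in> H"
  by (induction ps)
    (auto simp: lin_comb_Nil lin_comb_Cons zero_closed intro!: add_closed scale_closed)

lemma ip_lin_comb_right:
  assumes "g \<in> H" "\<And>x. x \<in> snd ` set ps \<Longrightarrow> \<Phi> x \<in> H"
  shows "ip g (lin_comb \<Phi> ps) = (\<Sum>(c, x)\<leftarrow>ps. cnj c * ip g (\<Phi> x))"
  using assms(2)
proof (induction ps)
  case (Cons p ps)
  obtain c x where p: "p = (c, x)" by fastforce
  have "lin_comb \<Phi> ps \<in> H" "\<Phi> x \<in> H"
    using Cons.prems by (auto simp: p intro!: lin_comb_closed)
  then show ?case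
    using Cons assms(1) by (simp add: p lin_comb_Cons ip_add_right ip_scale_right scale_closed)
qed (simp add: lin_comb_Nil ip_zero_right assms(1))

lemma sum_closed:
  "finite I \<Longrightarrow> (\<And>i. i \<in> I \<Longrightarrow> h i \<in> H) \<Longrightarrow> (\<lambda>x. \<Sum>i\<in>I. c i * h i x) \<in> H"
  by (induction I rule: finite_induct) (auto simp: zero_closed intro!: add_closed scale_closed)

lemma ip_sum_left:
  assumes "g \<in> H" "finite I" "\<And>i. i \<in> I \<Longrightarrow> h i \<in> H"
  shows "ip (\<lambda>x. \<Sum>i\<in>I. c i * h i x) g = (\<Sum>i\<in>I. c i * ip (h i) g)"
  using assms(2,3)
  by (induction I rule: finite_induct)
    (auto simp: ip_zero_left assms(1) ip_add ip_scale scale_closed sum_closed)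

lemma ip_sum_right:
  assumes "g \<in> H" "finite I" "\<And>i. i \<in> I \<Longrightarrow> h i \<in> H"
  shows "ip g (\<lambda>x. \<Sum>i\<in>I. c i * h i x) = (\<Sum>i\<in>I. cnj (c i) * ip g (h i))"
  using assms(2,3)
  by (induction I rule: finite_induct)
    (auto simp: ip_zero_right assms(1) ip_add_right ip_scale_right scale_closed sum_closed)

lemma ip_diff_scale_self:
  assumes "d \<in> H" "a \<in> H"
  shows "ip (\<lambda>x. d x - s * a x) (\<lambda>x. d x - s * a x) =
    ip d d - cnj s * ip d a - s * cnj (ip d a) + s * cnj s * ip a a"
proof -
  have sa: "(\<lambda>x. s * a x) \<in> H" using assms(2) by (rule scale_closed)
  have dsa: "(\<lambda>x. d x - s * a x) \<in> H" using assms(1) sa by (rule diff_closed)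
  show ?thesis
    unfolding ip_diff_left[OF assms(1) sa dsa] ip_diff_right[OF assms(1) sa assms(1)]
      ip_diff_right[OF assms(1) sa sa] ip_scale[OF assms(2,1)] ip_scale[OF assms(2) sa]
      ip_scale_right[OF assms(2,1)] ip_scale_right[OF assms(2,2)] ip_commute[OF assms]
    by (simp add: algebra_simps)
qed

text \<open>
  An approximate orthogonal projection onto \<open>N\<close>: if \<open>b\<close> minimises the squared distance to \<open>g\<close> up to \<open>\<epsilon>\<^sup>2\<close>, then moving \<open>b\<close> in the direction
  \<open>a\<close> gains at most \<open>\<epsilon>\<^sup>2\<close>, and the optimal move gains \<open>|\<langle>g - b, a\<rangle>|\<^sup>2 / \<parallel>a\<parallel>\<^sup>2\<close>.
\<close>

lemma almost_orthogonal_to_subspace: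
  assumes N: "N \<subseteq> H" "N \<noteq> {}"
    and closed: "\<And>a b c. a \<in> N \<Longrightarrow> b \<in> N \<Longrightarrow> (\<lambda>x. a x + c * b x) \<in> N"
    and g: "g \<in> H" and "0 < \<epsilon>"
  shows "\<exists>b\<in>N. \<forall>a\<in>N. cmod (ip (\<lambda>x. g x - b x) a) \<le> \<epsilon> * ip_norm ip a"
proof -
  define \<delta> where "\<delta> b = Re (ip (\<lambda>x. g x - b x) (\<lambda>x. g x - b x))" for b
  have \<delta>_nonneg: "0 \<le> \<delta> b" if "b \<in> N" for b
    using that N(1) g by (auto simp: \<delta>_def intro!: ip_nonneg diff_closed)
  define I where "I = Inf (\<delta> ` N)"
  have I_le: "I \<le> \<delta> b" if "b \<in> N" for b
    unfolding I_def using \<delta>_nonneg that by (intro cInf_lower bdd_belowI2[of _ 0]) auto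
  have "I < I + \<epsilon>\<^sup>2" using \<open>0 < \<epsilon>\<close> by simp
  then obtain b where b: "b \<in> N" "\<delta> b < I + \<epsilon>\<^sup>2"
    using cInf_lessD[of "\<delta> ` N" "I + \<epsilon>\<^sup>2"] N(2) by (auto simp: I_def)
  have "cmod (ip (\<lambda>x. g x - b x) a) \<le> \<epsilon> * ip_norm ip a" if a: "a \<in> N" for a
  proof (cases "ip_norm ip a = 0")
    case True
    have aH: "a \<in> H" and gb: "(\<lambda>x. g x - b x) \<in> H"
      using a b N g by (auto intro: diff_closed)
    show ?thesis using Cauchy_Schwarz[OF gb aH] True by simp
  next
    case False
    have aH: "a \<in> H" and gb: "(\<lambda>x. g x - b x) \<in> H" (is "?d \<in> H")
      using a b N g by (auto intro: diff_closed)
    define n where "n = (ip_norm ip a)\<^sup>2"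
    have n: "0 < n" "ip a a = of_real n" using False ip_self[OF aH] by (auto simp: n_def)
    \<comment> \<open>the coefficient of the projection of \<open>g - b\<close> onto the line through \<open>a\<close>\<close>
    define s where "s = ip ?d a / of_real n"
    have "(\<lambda>x. b x + s * a x) \<in> N" using a b closed by blast
    from I_le[OF this] have "I \<le> Re (ip (\<lambda>x. ?d x - s * a x) (\<lambda>x. ?d x - s * a x))"
      by (simp add: \<delta>_def algebra_simps)
    also have "ip (\<lambda>x. ?d x - s * a x) (\<lambda>x. ?d x - s * a x) =
        ip ?d ?d - cnj s * ip ?d a - s * cnj (ip ?d a) + s * cnj s * ip a a"
      by (rule ip_diff_scale_self[OF gb aH])
    also have "\<dots> = ip ?d ?d - of_real ((cmod (ip ?d a))\<^sup>2 / n)"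
      using n by (simp add: s_def field_simps complex_norm_square[unfolded of_real_power])
    finally have "I \<le> \<delta> b - (cmod (ip ?d a))\<^sup>2 / n"
      by (simp add: \<delta>_def)
    then have "(cmod (ip ?d a))\<^sup>2 / n \<le> \<epsilon>\<^sup>2" using b by simp
    then have "(cmod (ip ?d a))\<^sup>2 \<le> (\<epsilon> * ip_norm ip a)\<^sup>2"
      using n by (simp add: n_def field_simps)
    then show ?thesis
      using \<open>0 < \<epsilon>\<close> ip_norm_nonneg[OF aH] by (simp add: power2_le_iff_abs_le)
  qed
  then show ?thesis using b(1) by blast
qed

text \<open>
  Every \<open>g\<close> in the space may be tested, not only those in the closure of \<open>N\<close>, because the sequence
  lies in \<open>N\<close> and \<open>g\<close> differs from some element of \<open>N\<close> by a vector almost orthogonal to \<open>N\<close>.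
\<close>

lemma weakly_null_of_subspace:
  fixes a :: "nat \<Rightarrow> 'a \<Rightarrow> complex"
  assumes N: "N \<subseteq> H"
    and closed: "\<And>a b c. a \<in> N \<Longrightarrow> b \<in> N \<Longrightarrow> (\<lambda>x. a x + c * b x) \<in> N"
    and a: "\<And>n. a n \<in> N" and bounded: "\<And>n. ip_norm ip (a n) \<le> K"
    and null: "\<And>b. b \<in> N \<Longrightarrow> (\<lambda>n. ip b (a n)) \<longlonglongrightarrow> 0"
    and g: "g \<in> H"
  shows "(\<lambda>n. ip g (a n)) \<longlonglongrightarrow> 0"
proof (rule LIMSEQ_I)
  fix r :: real assume "0 < r"
  have aH: "a n \<in> H" for n using a N by blast
  have K: "0 \<le> K" using ip_norm_nonneg[OF aH] bounded order_trans by blast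
  define \<epsilon> where "\<epsilon> = r / (2 * (K + 1))"
  have "0 < \<epsilon>" using \<open>0 < r\<close> K by (simp add: \<epsilon>_def)
  obtain b where b: "b \<in> N" "\<And>c. c \<in> N \<Longrightarrow> cmod (ip (\<lambda>x. g x - b x) c) \<le> \<epsilon> * ip_norm ip c"
    using almost_orthogonal_to_subspace[OF N _ closed g \<open>0 < \<epsilon>\<close>] a by blast
  obtain n0 where n0: "\<And>n. n \<ge> n0 \<Longrightarrow> cmod (ip b (a n)) < r / 2"
    using LIMSEQ_D[OF null[OF b(1)], of "r/2"] \<open>0 < r\<close> by auto
  have "cmod (ip g (a n) - 0) < r" if "n \<ge> n0" for n
  proof -
    have "ip g (a n) = ip (\<lambda>x. g x - b x) (a n) + ip b (a n)"
      using g b(1) N aH by (subst ip_diff_left) auto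
    moreover have "cmod (ip (\<lambda>x. g x - b x) (a n)) \<le> \<epsilon> * K"
      using b(2)[OF a] bounded[of n] \<open>0 < \<epsilon>\<close> by (meson mult_left_mono order.strict_implies_order order_trans)
    moreover have "\<epsilon> * K \<le> r / 2" using K \<open>0 < r\<close> by (simp add: \<epsilon>_def field_simps)
    ultimately show ?thesis
      using n0[OF that] norm_triangle_ineq[of "ip (\<lambda>x. g x - b x) (a n)" "ip b (a n)"] by simp
  qed
  then show "\<exists>no. \<forall>n\<ge>no. cmod (ip g (a n) - 0) < r" by blast
qed

lemma ip_dist_eq: "g \<in> H \<Longrightarrow> h \<in> H \<Longrightarrow> ip_dist H ip g h = ip_norm ip (\<lambda>x. g x - h x)"
  by (simp add: ip_dist_def ip_norm_def)

lemma ip_dist_zero: "h \<in> H \<Longrightarrow> ip_dist H ip h (\<lambda>x. 0) = ip_norm ip h"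
  using ip_dist_eq[OF _ zero_closed] by simp

lemma mbounded_iff_ip_norm: "mbounded S \<longleftrightarrow> S \<subseteq> H \<and> (\<exists>K. \<forall>h\<in>S. ip_norm ip h \<le> K)"
proof
  assume "mbounded S"
  then obtain x B where xB: "S \<subseteq> mcball x B" by (auto simp: mbounded_def)
  have "ip_norm ip h \<le> B + ip_dist H ip x (\<lambda>x. 0)" if "h \<in> S" for h
  proof -
    have h: "h \<in> H" "x \<in> H" "ip_dist H ip x h \<le> B" using that xB by auto
    have "ip_norm ip h = ip_dist H ip h (\<lambda>x. 0)" using h by (simp add: ip_dist_zero)
    also have "\<dots> \<le> ip_dist H ip h x + ip_dist H ip x (\<lambda>x. 0)"
      using h zero_closed by (intro triangle)
    finally show ?thesis using h commute[of h x] by simp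
  qed
  then show "S \<subseteq> H \<and> (\<exists>K. \<forall>h\<in>S. ip_norm ip h \<le> K)" using xB by auto
next
  assume *: "S \<subseteq> H \<and> (\<exists>K. \<forall>h\<in>S. ip_norm ip h \<le> K)"
  then obtain K where K: "\<And>h. h \<in> S \<Longrightarrow> ip_norm ip h \<le> K" by blast
  have "ip_dist H ip (\<lambda>x. 0) h \<le> K" if "h \<in> S" for h
    using commute[of "\<lambda>x. 0" h] ip_dist_zero[of h] K[OF that] * that by auto
  then have "S \<subseteq> mcball (\<lambda>x. 0) K" using * zero_closed by auto
  then show "mbounded S" unfolding mbounded_def by blast
qed

end

section \<open>Compact operators\<close>

lemma compact_operator_bounded:
  assumes "function_inner_product_space E H ip" "function_inner_product_space E' H' ip'"
    and compact: "compact_operator H ip H' ip' T"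
    and scale: "\<And>c h. h \<in> H \<Longrightarrow> T (\<lambda>x. c * h x) = (\<lambda>x. c * T h x)"
  shows "\<exists>K\<ge>0. \<forall>h\<in>H. ip_norm ip' (T h) \<le> K * ip_norm ip h"
proof -
  interpret D: function_inner_product_space E H ip by fact
  interpret R: function_inner_product_space E' H' ip' by fact
  define B where "B = {h \<in> H. ip_norm ip h \<le> 1}"
  have TH: "T ` H \<subseteq> H'" using compact by (simp add: compact_operator_def)
  have "D.mbounded B" unfolding D.mbounded_iff_ip_norm B_def by auto
  then have "compactin R.mtopology (R.mtopology closure_of (T ` B))"
    using compact by (simp add: compact_operator_def)
  then have "R.mbounded (R.mtopology closure_of (T ` B))" by (rule R.compactin_imp_mbounded)
  moreover have "T ` B \<subseteq> R.mtopology closure_of (T ` B)"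
    using TH by (intro closure_of_subset) (auto simp: B_def)
  ultimately obtain K where K: "\<And>h. h \<in> B \<Longrightarrow> ip_norm ip' (T h) \<le> K"
    unfolding R.mbounded_iff_ip_norm by blast
  have "ip_norm ip' (T h) \<le> \<bar>K\<bar> * ip_norm ip h" if h: "h \<in> H" for h
  proof (cases "ip_norm ip h = 0")
    case True
    then have "h = (\<lambda>x. 0)" using D.ip_definite[OF h] D.ip_self[OF h] by simp
    then have "T h = (\<lambda>x. 0)" using scale[OF D.zero_closed, of 0] by simp
    then show ?thesis using True by (simp add: R.ip_norm_zero)
  next
    case False
    define n where "n = ip_norm ip h"
    have n: "0 < n" using False D.ip_norm_nonneg[OF h] by (simp add: n_def)
    have "(\<lambda>x. of_real (1 / n) * h x) \<in> B"
      using n h by (simp add: B_def D.scale_closed D.ip_norm_scale norm_divide n_def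
          del: of_real_divide)
    from K[OF this] have "ip_norm ip' (T h) / n \<le> K"
      using n TH h by (subst (asm) scale[OF h], subst (asm) R.ip_norm_scale) (auto simp: norm_divide)
    then show ?thesis using n by (auto simp: n_def field_simps intro: order_trans mult_left_mono)
  qed
  then show ?thesis by (intro exI[of _ "\<bar>K\<bar>"]) auto
qed

text \<open>
  Along a subsequence the images \<open>T (h n)\<close> converge in norm to some \<open>g\<close>; pairing with \<open>a n\<close> then
  differs from \<open>\<langle>g, a n\<rangle>\<close> by a null sequence.
\<close>

lemma compact_operator_weakly_null_pairing:
  fixes h :: "nat \<Rightarrow> 'b \<Rightarrow> complex" and a :: "nat \<Rightarrow> 'a \<Rightarrow> complex"
  assumes "function_inner_product_space E H ip" "function_inner_product_space E' H' ip'"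
    and compact: "compact_operator H ip H' ip' T"
    and h: "\<And>n. h n \<in> H" "\<And>n. ip_norm ip (h n) \<le> K"
    and a: "\<And>n. a n \<in> H'" "\<And>n. ip_norm ip' (a n) \<le> K'"
    and null: "\<And>g. g \<in> H' \<Longrightarrow> (\<lambda>n. ip' g (a n)) \<longlonglongrightarrow> 0"
  shows "\<exists>r. strict_mono r \<and> (\<lambda>n. ip' (T (h (r n))) (a (r n))) \<longlonglongrightarrow> 0"
proof -
  interpret D: function_inner_product_space E H ip by fact
  interpret R: function_inner_product_space E' H' ip' by fact
  have TH: "T (h n) \<in> H'" for n using compact h by (auto simp: compact_operator_def)
  have "D.mbounded (range h)" unfolding D.mbounded_iff_ip_norm using h by blast
  then have "compactin R.mtopology (R.mtopology closure_of (T ` range h))"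
    using compact by (simp add: compact_operator_def)
  moreover have "range (\<lambda>n. T (h n)) \<subseteq> R.mtopology closure_of (T ` range h)"
    using closure_of_subset[of "T ` range h" R.mtopology] TH by auto
  ultimately obtain g r where g: "strict_mono r"
      "limitin R.mtopology ((\<lambda>n. T (h n)) \<circ> r) g sequentially"
    unfolding R.compactin_sequentially by blast
  then have gH: "g \<in> H'" and lim: "(\<lambda>n. ip_dist H' ip' (T (h (r n))) g) \<longlonglongrightarrow> 0"
    by (auto simp: R.limitin_metric_dist_null comp_def)
  have "(\<lambda>n. ip' (\<lambda>x. T (h (r n)) x - g x) (a (r n))) \<longlonglongrightarrow> 0"
  proof (rule Lim_null_comparison)
    have "cmod (ip' (\<lambda>x. T (h (r n)) x - g x) (a (r n)))
        \<le> ip_dist H' ip' (T (h (r n))) g * K'" for n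
    proof -
      have d: "(\<lambda>x. T (h (r n)) x - g x) \<in> H'" using TH gH by (rule R.diff_closed)
      show ?thesis
        using R.Cauchy_Schwarz[OF d a(1)] mult_left_mono[OF a(2) R.ip_norm_nonneg[OF d]]
          R.ip_dist_eq[OF TH gH] order_trans by fastforce
    qed
    then show "\<forall>\<^sub>F n in sequentially. cmod (ip' (\<lambda>x. T (h (r n)) x - g x) (a (r n)))
        \<le> ip_dist H' ip' (T (h (r n))) g * K'" by simp
    show "(\<lambda>n. ip_dist H' ip' (T (h (r n))) g * K') \<longlonglongrightarrow> 0"
      using tendsto_mult_left_zero[OF lim] .
  qed
  moreover have "(\<lambda>n. ip' g (a (r n))) \<longlonglongrightarrow> 0"
    using LIMSEQ_subseq_LIMSEQ[OF null[OF gH] g(1)] by (simp add: comp_def)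
  ultimately have "(\<lambda>n. ip' (\<lambda>x. T (h (r n)) x - g x) (a (r n)) + ip' g (a (r n))) \<longlonglongrightarrow> 0"
    using tendsto_add by fastforce
  moreover have "ip' (\<lambda>x. T (h (r n)) x - g x) (a (r n)) + ip' g (a (r n))
      = ip' (T (h (r n))) (a (r n))" for n
    using R.ip_diff_left[OF TH gH a(1)] by simp
  ultimately show ?thesis using g(1) by auto
qed

section \<open>Composition operators and their adjoints\<close>

locale bounded_composition = dom: rkhs E k H ip + cod: rkhs U l H' ip'
  for E :: "'b set" and k H ip and U :: "'a set" and l H' ip' +
  fixes f :: "'a \<Rightarrow> 'b" and K :: real
  assumes maps: "f ` U \<subseteq> E"
    and range: "h \<in> H \<Longrightarrow> composition_operator U f h \<in> H'"
    and bound: "h \<in> H \<Longrightarrow> ip_norm ip' (composition_operator U f h) \<le> K * ip_norm ip h"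
    and bound_nonneg: "0 \<le> K"
begin

text \<open>
  The adjoint of the composition operator maps \<open>source ps\<close> to \<open>target ps\<close>.
\<close>

abbreviation "source ps \<equiv> lin_comb (kernel_section U l) ps"
abbreviation "target ps \<equiv> lin_comb (\<lambda>x. kernel_section E k (f x)) ps"

lemma source_in: "snd ` set ps \<subseteq> U \<Longrightarrow> source ps \<in> H'"
  by (intro cod.lin_comb_closed cod.section_in) auto

lemma target_in: "snd ` set ps \<subseteq> U \<Longrightarrow> target ps \<in> H"
  using maps by (intro dom.lin_comb_closed dom.section_in) auto

lemma adjoint:
  assumes "snd ` set ps \<subseteq> U" "h \<in> H"
  shows "ip' (composition_operator U f h) (source ps) = ip h (target ps)"
proof -
  have "ip' (composition_operator U f h) (source ps)
      = (\<Sum>(c, x)\<leftarrow>ps. cnj c * ip' (composition_operator U f h) (kernel_section U l x))"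
    using assms range cod.section_in by (intro cod.ip_lin_comb_right) auto
  also have "\<dots> = (\<Sum>(c, x)\<leftarrow>ps. cnj c * ip h (kernel_section E k (f x)))"
  proof (intro arg_cong[of _ _ sum_list] map_cong refl, clarify)
    fix c x assume "(c, x) \<in> set ps"
    then have "x \<in> U" "f x \<in> E" using assms maps by force+
    then show "cnj c * ip' (composition_operator U f h) (kernel_section U l x)
        = cnj c * ip h (kernel_section E k (f x))"
      using assms range
      by (simp add: cod.reproducing dom.reproducing) (simp add: composition_operator_def)
  qed
  also have "\<dots> = ip h (target ps)"
    using assms maps dom.section_in by (intro dom.ip_lin_comb_right[symmetric]) auto
  finally show ?thesis .
qed

text \<open>
  Take \<open>h\<close> to be the target itself in \<open>adjoint\<close> and apply the Cauchy--Schwarz inequality.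
\<close>

lemma target_norm_le:
  assumes "snd ` set ps \<subseteq> U"
  shows "ip_norm ip (target ps) \<le> K * ip_norm ip' (source ps)"
proof -
  let ?b = "target ps" and ?a = "source ps"
  note b = target_in[OF assms] and a = source_in[OF assms]
  have "(ip_norm ip ?b)\<^sup>2 = cmod (ip' (composition_operator U f ?b) ?a)"
    using adjoint[OF assms b] dom.ip_self[OF b] by (simp add: norm_power)
  also have "\<dots> \<le> ip_norm ip' (composition_operator U f ?b) * ip_norm ip' ?a"
    using range b a by (intro cod.Cauchy_Schwarz)
  also have "\<dots> \<le> (K * ip_norm ip ?b) * ip_norm ip' ?a"
    using bound[OF b] cod.ip_norm_nonneg[OF a] by (rule mult_right_mono)
  finally have "ip_norm ip ?b * ip_norm ip ?b \<le> ip_norm ip ?b * (K * ip_norm ip' ?a)"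
    by (simp add: power2_eq_square mult_ac)
  then show ?thesis
    using dom.ip_norm_nonneg[OF b] bound_nonneg cod.ip_norm_nonneg[OF a]
    by (cases "ip_norm ip ?b = 0") (auto simp: mult_le_cancel_left)
qed

end

section \<open>Bernstein polynomials of the exponential\<close>

lemma power2_le_exp:
  fixes y :: real assumes "0 \<le> y" shows "y\<^sup>2 \<le> 2 * exp y"
  using exp_lower_Taylor_quadratic[OF assms] assms by (simp add: field_simps)

lemma norm_cis_diff_1_le: "cmod (cis u - 1) \<le> \<bar>u\<bar>"
  using Taylor_exp[of "\<i> * of_real u" 0] by (simp add: cis_conv_exp norm_mult)

lemma bernstein_factor_bound:
  assumes "cmod z \<le> R"
  shows "cmod (1 + z * (cis u - 1)) \<le> exp (R * \<bar>u\<bar>)"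
proof -
  have "cmod (1 + z * (cis u - 1)) \<le> 1 + cmod z * cmod (cis u - 1)"
    by (rule order_trans[OF norm_triangle_ineq]) (simp add: norm_mult)
  also have "\<dots> \<le> 1 + R * \<bar>u\<bar>"
    using assms norm_cis_diff_1_le[of u] order_trans[OF norm_ge_zero assms]
    by (intro add_left_mono mult_mono) auto
  finally show ?thesis
    using exp_ge_add_one_self[of "R * \<bar>u\<bar>"] by linarith
qed

text \<open>
  \<open>(1 + z (q - 1))\<^sup>m\<close> with \<open>q = cis (x / m)\<close> is the \<open>m\<close>-th Bernstein polynomial of
  \<open>t \<mapsto> exp (\<i> t x)\<close> on \<open>[0, 1]\<close>, evaluated at the complex argument \<open>z\<close>.
\<close>

lemma bernstein_exp_bound:
  assumes "cmod z \<le> R" "0 < m"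
  shows "cmod ((1 + z * (cis (x / real m) - 1)) ^ m) \<le> exp (R * \<bar>x\<bar>)"
proof -
  have "cmod ((1 + z * (cis (x / real m) - 1)) ^ m) \<le> exp (R * \<bar>x / real m\<bar>) ^ m"
    unfolding norm_power by (intro power_mono bernstein_factor_bound[OF assms(1)] norm_ge_zero)
  also have "\<dots> = exp (R * \<bar>x\<bar>)"
    using assms(2) by (simp add: exp_of_nat_mult[symmetric])
  finally show ?thesis .
qed

text \<open>
  Both terms are \<open>m\<close>-th powers, of \<open>a = 1 + z (q - 1)\<close> and \<open>b = exp (\<i> z x / m)\<close>.  These agree to
  first order in \<open>1 / m\<close>, so their difference is \<open>O(1 / m\<^sup>2)\<close>, and taking powers loses a factor \<open>m\<close>.
\<close>

lemma bernstein_exp_error: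
  fixes z :: complex and x R :: real
  assumes z: "cmod z \<le> R" and R: "1 \<le> R" and m: "0 < m"
  shows "cmod ((1 + z * (cis (x / real m) - 1)) ^ m - exp (z * (\<i> * of_real x)))
    \<le> 4 / real m * exp (2 * R * \<bar>x\<bar>)"
proof -
  define u where "u = x / real m"
  define K where "K = exp (R * \<bar>u\<bar>)"
  define a where "a = 1 + z * (cis u - 1)"
  define b where "b = exp (z * (\<i> * of_real u))"
  have R0: "0 \<le> R" using R by simp
  have K: "1 \<le> K" using R0 by (simp add: K_def)
  have cis2: "cmod (cis u - (1 + \<i> * of_real u)) \<le> u\<^sup>2"
    using Taylor_exp[of "\<i> * of_real u" 1]
    by (simp add: cis_conv_exp norm_mult power2_eq_square)
  have zu: "cmod (z * (\<i> * of_real u)) \<le> R * \<bar>u\<bar>"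
    using z by (simp add: norm_mult mult_right_mono)
  have a_le: "cmod a \<le> K"
    unfolding a_def K_def by (rule bernstein_factor_bound[OF z])
  have b_le: "cmod b \<le> K"
    unfolding b_def K_def by (rule order_trans[OF norm_exp]) (use zu in simp)
  have "cmod (a - b) \<le> cmod (z * (cis u - (1 + \<i> * of_real u)))
      + cmod (b - (1 + z * (\<i> * of_real u)))"
    by (rule order_trans[OF _ norm_triangle_ineq4]) (simp add: a_def algebra_simps)
  also have "cmod (z * (cis u - (1 + \<i> * of_real u))) \<le> R * u\<^sup>2"
    using z cis2 R0 by (simp add: norm_mult mult_mono)
  also have "cmod (b - (1 + z * (\<i> * of_real u))) \<le> K * (R * \<bar>u\<bar>)\<^sup>2"
  proof -
    have "cmod (b - (1 + z * (\<i> * of_real u)))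
        \<le> exp (cmod (z * (\<i> * of_real u))) * cmod (z * (\<i> * of_real u)) ^ 2"
      using Taylor_exp_field[of "z * (\<i> * of_real u)" 1] by (simp add: b_def power2_eq_square)
    also have "\<dots> \<le> K * (R * \<bar>u\<bar>)\<^sup>2"
      unfolding K_def using zu by (intro mult_mono power_mono) auto
    finally show ?thesis .
  qed
  also have "R * u\<^sup>2 + K * (R * \<bar>u\<bar>)\<^sup>2 \<le> 2 * K * (R * \<bar>u\<bar>)\<^sup>2"
  proof -
    have "R * u\<^sup>2 \<le> (R * \<bar>u\<bar>)\<^sup>2"
      using R mult_right_mono[of R "R\<^sup>2" "u\<^sup>2"] by (simp add: power_mult_distrib self_le_power)
    also have "\<dots> \<le> K * (R * \<bar>u\<bar>)\<^sup>2" using K by (simp add: mult_le_cancel_right1)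
    finally show ?thesis by simp
  qed
  finally have ab: "cmod (a - b) \<le> 2 * K * (R * \<bar>u\<bar>)\<^sup>2" by simp
  \<comment> \<open>after division by \<open>K\<close> both bases lie in the unit disc, where the \<open>m\<close>-th power is \<open>m\<close>-Lipschitz\<close>
  have "cmod ((a / of_real K) ^ m - (b / of_real K) ^ m)
      \<le> real m * cmod (a / of_real K - b / of_real K)"
    using a_le b_le K by (intro norm_power_diff) (auto simp: norm_divide)
  moreover have "(a / of_real K) ^ m - (b / of_real K) ^ m = (a ^ m - b ^ m) / of_real (K ^ m)"
    by (simp add: power_divide diff_divide_distrib)
  moreover have "a / of_real K - b / of_real K = (a - b) / of_real K"
    by (simp add: diff_divide_distrib)
  ultimately have "cmod (a ^ m - b ^ m) / K ^ m \<le> real m * (cmod (a - b) / K)"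
    using K by (simp add: norm_divide norm_power)
  also have "\<dots> \<le> real m * (2 * (R * \<bar>u\<bar>)\<^sup>2)"
    using ab K by (intro mult_left_mono) (auto simp: field_simps)
  finally have "cmod (a ^ m - b ^ m) \<le> real m * (2 * (R * \<bar>u\<bar>)\<^sup>2) * K ^ m"
    using K by (simp add: field_simps)
  also have "K ^ m = exp (R * \<bar>x\<bar>)"
    using m by (simp add: K_def u_def exp_of_nat_mult[symmetric])
  also have "real m * (2 * (R * \<bar>u\<bar>)\<^sup>2) = 2 / real m * (R * \<bar>x\<bar>)\<^sup>2"
    using m by (simp add: u_def power2_eq_square field_simps)
  also have "2 / real m * (R * \<bar>x\<bar>)\<^sup>2 * exp (R * \<bar>x\<bar>)
      \<le> 2 / real m * (2 * exp (R * \<bar>x\<bar>)) * exp (R * \<bar>x\<bar>)"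
    using R0 by (intro mult_right_mono mult_left_mono power2_le_exp) auto
  also have "\<dots> = 4 / real m * exp (2 * R * \<bar>x\<bar>)"
    by (simp add: exp_add[symmetric])
  finally show ?thesis
    using m by (simp add: a_def b_def u_def exp_of_nat_mult[symmetric] mult_ac)
qed

section \<open>Reproducing kernel Hilbert spaces of Fourier transforms\<close>

definition character :: "'a::real_inner \<Rightarrow> 'a \<Rightarrow> complex" where
  "character x \<xi> = cis (- 2 * pi * (x \<bullet> \<xi>))"

lemma character_zero: "character 0 \<xi> = 1"
  by (simp add: character_def)

lemma norm_character: "cmod (character x \<xi>) = 1"
  by (simp add: character_def)

lemma character_add: "character (x + y) \<xi> = character x \<xi> * character y \<xi>"
  by (simp add: character_def cis_mult inner_add_left algebra_simps)

lemma character_diff: "character (x - y) \<xi> = character x \<xi> * cnj (character y \<xi>)"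
  by (simp add: character_def cis_mult cis_cnj inner_diff_left algebra_simps)

lemma character_scaleR:
  "character (t *\<^sub>R v) \<xi> = exp (of_real t * (\<i> * of_real (- 2 * pi * (v \<bullet> \<xi>))))"
  by (simp add: character_def cis_conv_exp algebra_simps)

lemma borel_measurable_cnj [measurable]:
  assumes "f \<in> borel_measurable M"
  shows "(\<lambda>x. cnj (f x)) \<in> borel_measurable M"
  by (rule measurable_compose[OF assms])
    (intro borel_measurable_continuous_onI continuous_intros)

locale exponential_moments =
  fixes M :: "'a::euclidean_space measure"
  assumes measurable_ident: "(\<lambda>\<xi>. \<xi>) \<in> borel_measurable M"
    and exp_moment: "integrable M (\<lambda>\<xi>. exp (a * norm \<xi>))"
begin

sublocale finite_measure M
proof (rule finite_measureI)
  have "(\<integral>\<^sup>+\<xi>. 1 \<partial>M) < \<infinity>"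
    using exp_moment[of 0] by (simp add: integrable_iff_bounded)
  then show "emeasure M (space M) \<noteq> \<infinity>" by simp
qed

definition mass :: real where
  "mass = measure M (space M)"

definition exp_L1 :: "real \<Rightarrow> real" where
  "exp_L1 a = (\<integral>\<xi>. exp (a * norm \<xi>) \<partial>M)"

lemma exp_L1_nonneg: "0 \<le> exp_L1 a"
  by (simp add: exp_L1_def)

lemma measurable_character [measurable]: "character x \<in> borel_measurable M"
proof -
  have "continuous_on UNIV (character x)"
    unfolding character_def[abs_def] by (intro continuous_intros)
  then have "character x \<in> borel_measurable borel" by (rule borel_measurable_continuous_onI)
  then show ?thesis by (rule measurable_compose[OF measurable_ident])
qed

lemma measurable_lin_comb_character [measurable]:
  "lin_comb character ps \<in> borel_measurable M"
proof (induction ps)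
  case (Cons p ps)
  then show ?case by (cases p) (simp add: lin_comb_Cons)
qed (simp add: lin_comb_Nil)

lemma norm_lin_comb_character_le: "cmod (lin_comb character ps \<xi>) \<le> (\<Sum>(c, x)\<leftarrow>ps. cmod c)"
proof (induction ps)
  case (Cons p ps)
  then show ?case
    by (cases p)
      (auto simp: lin_comb_Cons norm_mult norm_character intro: order_trans[OF norm_triangle_ineq])
qed (simp add: lin_comb_Nil)

lemma integrable_exp_bounded:
  fixes F :: "'a \<Rightarrow> complex"
  assumes "F \<in> borel_measurable M" "\<And>\<xi>. cmod (F \<xi>) \<le> C * exp (a * norm \<xi>)"
  shows "integrable M F" "cmod (\<integral>\<xi>. F \<xi> \<partial>M) \<le> C * exp_L1 a"
proof -
  have int: "integrable M (\<lambda>\<xi>. C * exp (a * norm \<xi>))" using exp_moment by simp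
  show F: "integrable M F"
    by (rule Bochner_Integration.integrable_bound[OF int assms(1)])
      (use assms(2) in \<open>auto intro: order_trans[OF _ abs_ge_self]\<close>)
  have "cmod (\<integral>\<xi>. F \<xi> \<partial>M) \<le> (\<integral>\<xi>. cmod (F \<xi>) \<partial>M)" by (rule integral_norm_bound)
  also have "\<dots> \<le> (\<integral>\<xi>. C * exp (a * norm \<xi>) \<partial>M)"
    using F int assms(2) by (intro integral_mono) auto
  finally show "cmod (\<integral>\<xi>. F \<xi> \<partial>M) \<le> C * exp_L1 a" by (simp add: exp_L1_def)
qed

lemma integrable_lin_comb_character:
  assumes "G \<in> borel_measurable M" "\<And>\<xi>. cmod (G \<xi>) \<le> C"
  shows "integrable M (\<lambda>\<xi>. lin_comb character ps \<xi> * G \<xi>)"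
proof (rule integrable_exp_bounded(1)[where a = 0])
  show "cmod (lin_comb character ps \<xi> * G \<xi>) \<le> (\<Sum>(c, x)\<leftarrow>ps. cmod c) * C * exp (0 * norm \<xi>)" for \<xi>
    using mult_mono[OF norm_lin_comb_character_le[of ps \<xi>] assms(2)[of \<xi>]]
      order_trans[OF norm_ge_zero norm_lin_comb_character_le[of ps \<xi>]]
    by (simp add: norm_mult)
qed (use assms(1) in measurable)

end

text \<open>
  The feature map of the kernel sends \<open>x\<close> to \<open>character x\<close> in \<open>L\<^sup>2(M)\<close>; on combinations of kernel
  sections it is isometric (\<open>ip_lin_comb\<close>), which turns pointwise estimates of characters into norm
  estimates in the abstract space.
\<close>

locale fourier_rkhs = rkhs E k H ip + exponential_moments M
  for E :: "'a::euclidean_space set" and k H ip and M :: "'a measure" +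
  assumes kernel: "k x y = (\<integral>\<xi>. character (x - y) \<xi> \<partial>M)"
begin

lemma lin_comb_eval:
  assumes "y \<in> E"
  shows "lin_comb (kernel_section E k) ps y
    = (\<integral>\<xi>. lin_comb character ps \<xi> * cnj (character y \<xi>) \<partial>M)"
proof (induction ps)
  case (Cons p ps)
  obtain c x where p: "p = (c, x)" by fastforce
  have "integrable M (\<lambda>\<xi>. lin_comb character qs \<xi> * cnj (character y \<xi>))" for qs
    by (rule integrable_lin_comb_character[where C = 1]) (auto simp: norm_character)
  from this[of "[(c, x)]"] this[of ps]
  have "(\<integral>\<xi>. lin_comb character (p # ps) \<xi> * cnj (character y \<xi>) \<partial>M)
      = (\<integral>\<xi>. c * (character x \<xi> * cnj (character y \<xi>)) \<partial>M)
        + (\<integral>\<xi>. lin_comb character ps \<xi> * cnj (character y \<xi>) \<partial>M)"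
    by (subst Bochner_Integration.integral_add[symmetric])
      (auto simp: p lin_comb_Cons lin_comb_Nil algebra_simps)
  also have "(\<integral>\<xi>. c * (character x \<xi> * cnj (character y \<xi>)) \<partial>M) = c * k x y"
    by (simp add: kernel character_diff)
  finally show ?case using Cons assms by (simp add: p lin_comb_Cons kernel_section_def)
qed (simp add: lin_comb_Nil)

lemma ip_lin_comb:
  assumes "snd ` set ps \<subseteq> E" "snd ` set qs \<subseteq> E"
  shows "ip (lin_comb (kernel_section E k) ps) (lin_comb (kernel_section E k) qs)
    = (\<integral>\<xi>. lin_comb character ps \<xi> * cnj (lin_comb character qs \<xi>) \<partial>M)"
proof -
  let ?g = "lin_comb (kernel_section E k) ps"
  have g: "?g \<in> H" using assms(1) section_in by (intro lin_comb_closed) auto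
  show ?thesis
    using assms(2)
  proof (induction qs)
    case (Cons q qs)
    obtain d y where q: "q = (d, y)" by fastforce
    have y: "y \<in> E" and qs: "snd ` set qs \<subseteq> E" using Cons.prems by (auto simp: q)
    have H: "lin_comb (kernel_section E k) qs \<in> H" "kernel_section E k y \<in> H"
      using y qs section_in by (auto intro!: lin_comb_closed)
    have "ip ?g (lin_comb (kernel_section E k) (q # qs))
        = cnj d * ?g y + ip ?g (lin_comb (kernel_section E k) qs)"
      using H g y by (simp add: q lin_comb_Cons ip_add_right ip_scale_right scale_closed reproducing)
    also have "cnj d * ?g y
        = (\<integral>\<xi>. cnj d * (lin_comb character ps \<xi> * cnj (character y \<xi>)) \<partial>M)"
      by (simp add: lin_comb_eval[OF y])
    also have "\<dots> + ip ?g (lin_comb (kernel_section E k) qs)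
        = (\<integral>\<xi>. lin_comb character ps \<xi> * cnj (lin_comb character (q # qs) \<xi>) \<partial>M)"
      unfolding Cons.IH[OF qs]
    proof (subst Bochner_Integration.integral_add[symmetric])
      show "integrable M (\<lambda>\<xi>. cnj d * (lin_comb character ps \<xi> * cnj (character y \<xi>)))"
        using integrable_lin_comb_character[of "\<lambda>\<xi>. cnj (character y \<xi>)" 1 ps]
        by (auto simp: norm_character)
      show "integrable M (\<lambda>\<xi>. lin_comb character ps \<xi> * cnj (lin_comb character qs \<xi>))"
        using norm_lin_comb_character_le[of qs]
        by (intro integrable_lin_comb_character) auto
    qed (simp add: q lin_comb_Cons algebra_simps)
    finally show ?case .
  qed (simp add: lin_comb_Nil ip_zero_right g)
qed

lemma ip_norm_lin_comb_le:
  assumes ps: "snd ` set ps \<subseteq> E" and C: "0 \<le> C"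
    and bound: "\<And>\<xi>. cmod (lin_comb character ps \<xi>) \<le> C * exp (a * norm \<xi>)"
  shows "ip_norm ip (lin_comb (kernel_section E k) ps) \<le> C * sqrt (exp_L1 (2 * a))"
proof -
  let ?F = "lin_comb character ps"
  have "Re (ip (lin_comb (kernel_section E k) ps) (lin_comb (kernel_section E k) ps))
      \<le> cmod (\<integral>\<xi>. ?F \<xi> * cnj (?F \<xi>) \<partial>M)"
    unfolding ip_lin_comb[OF ps ps] by (rule complex_Re_le_cmod)
  also have "\<dots> \<le> C\<^sup>2 * exp_L1 (2 * a)"
  proof (rule integrable_exp_bounded(2))
    fix \<xi>
    have "cmod (?F \<xi> * cnj (?F \<xi>)) = (cmod (?F \<xi>))\<^sup>2"
      by (simp add: norm_mult power2_eq_square)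
    also have "\<dots> \<le> (C * exp (a * norm \<xi>))\<^sup>2" using bound by (intro power_mono) auto
    also have "\<dots> = C\<^sup>2 * exp (2 * a * norm \<xi>)"
      by (simp add: power_mult_distrib exp_double[symmetric] mult_ac)
    finally show "cmod (?F \<xi> * cnj (?F \<xi>)) \<le> C\<^sup>2 * exp (2 * a * norm \<xi>)" .
  qed measurable
  finally have "ip_norm ip (lin_comb (kernel_section E k) ps) \<le> sqrt (C\<^sup>2 * exp_L1 (2 * a))"
    unfolding ip_norm_def by (rule real_sqrt_le_mono)
  then show ?thesis using C by (simp add: real_sqrt_mult)
qed

lemma ip_norm_section: "x \<in> E \<Longrightarrow> ip_norm ip (kernel_section E k x) = sqrt mass"
  using reproducing[OF section_in, of x x]
  by (simp add: ip_norm_def kernel_section_def kernel character_zero mass_def)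

end

section \<open>Analytic continuation along a line\<close>

text \<open>
  The \<open>m\<close>-th Bernstein polynomial, at \<open>z\<close>, of the curve of points \<open>t \<mapsto> p + t v\<close>, as a formal
  combination of points.  For \<open>z\<close> outside \<open>[0, 1]\<close> the nodes still lie on the segment.
\<close>

definition bernstein_comb :: "'a::real_vector \<Rightarrow> 'a \<Rightarrow> nat \<Rightarrow> complex \<Rightarrow> (complex \<times> 'a) list" where
  "bernstein_comb p v m z =
    map (\<lambda>j. (of_nat (m choose j) * z ^ j * (1 - z) ^ (m - j), p + (real j / real m) *\<^sub>R v)) [0..<Suc m]"

lemma lin_comb_bernstein:
  "lin_comb \<Phi> (bernstein_comb p v m z) y =
    (\<Sum>j\<le>m. of_nat (m choose j) * z ^ j * (1 - z) ^ (m - j) * \<Phi> (p + (real j / real m) *\<^sub>R v) y)"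
proof -
  have "lin_comb \<Phi> (bernstein_comb p v m z) y =
    (\<Sum>j\<leftarrow>[0..<Suc m]. of_nat (m choose j) * z ^ j * (1 - z) ^ (m - j) * \<Phi> (p + (real j / real m) *\<^sub>R v) y)"
    unfolding lin_comb_def bernstein_comb_def by (simp add: comp_def del: upt_Suc)
  also have "\<dots> = (\<Sum>j\<in>set [0..<Suc m]. of_nat (m choose j) * z ^ j * (1 - z) ^ (m - j) * \<Phi> (p + (real j / real m) *\<^sub>R v) y)"
    by (rule sum_list_distinct_conv_sum_set) simp
  also have "set [0..<Suc m] = {..m}" by auto
  finally show ?thesis .
qed

lemma points_bernstein_comb:
  assumes "\<And>s. 0 \<le> s \<Longrightarrow> s \<le> 1 \<Longrightarrow> p + s *\<^sub>R v \<in> U" "0 < m"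
  shows "snd ` set (bernstein_comb p v m z) \<subseteq> U"
  using assms by (auto simp: bernstein_comb_def simp del: upt_Suc)

text \<open>
  A character is multiplicative along the line, so the binomial theorem sums the Bernstein polynomial.
\<close>

lemma lin_comb_character_bernstein:
  assumes "0 < m"
  shows "lin_comb character (bernstein_comb p v m z) \<xi> =
    character p \<xi> * (1 + z * (cis (- 2 * pi * (v \<bullet> \<xi>) / real m) - 1)) ^ m"
proof -
  define q where "q = cis (- 2 * pi * (v \<bullet> \<xi>) / real m)"
  have ch: "character (p + (real j / real m) *\<^sub>R v) \<xi> = character p \<xi> * q ^ j" for j
  proof -
    have "character ((real j / real m) *\<^sub>R v) \<xi> = cis (real j * (- 2 * pi * (v \<bullet> \<xi>) / real m))"
      unfolding character_def by (rule arg_cong[of _ _ cis]) simp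
    also have "\<dots> = q ^ j" unfolding q_def by (rule Complex.DeMoivre[symmetric])
    finally show ?thesis by (simp only: character_add)
  qed
  have "(1 + z * (q - 1)) ^ m = (z * q + (1 - z)) ^ m" by (simp add: algebra_simps)
  also have "\<dots> = (\<Sum>j\<le>m. of_nat (m choose j) * (z * q) ^ j * (1 - z) ^ (m - j))"
    by (rule binomial_ring)
  finally show ?thesis
    unfolding lin_comb_bernstein ch q_def[symmetric]
    by (simp add: sum_distrib_left power_mult_distrib mult_ac)
qed

lemma bernstein_comb_bound:
  assumes "cmod z \<le> R" "0 < m"
  shows "cmod (lin_comb character (bernstein_comb p v m z) \<xi>)
    \<le> exp (2 * pi * R * norm v * norm \<xi>)"
proof -
  have R: "0 \<le> R" using assms(1) order_trans[OF norm_ge_zero] by blast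
  have "cmod (lin_comb character (bernstein_comb p v m z) \<xi>) \<le> exp (R * \<bar>- 2 * pi * (v \<bullet> \<xi>)\<bar>)"
    unfolding lin_comb_character_bernstein[OF assms(2)] norm_mult norm_character
    using bernstein_exp_bound[OF assms, of "- 2 * pi * (v \<bullet> \<xi>)"] by simp
  also have "\<dots> \<le> exp (2 * pi * R * norm v * norm \<xi>)"
    using mult_left_mono[OF Cauchy_Schwarz_ineq2[of v \<xi>], of "2 * pi * R"] R
    by (simp add: abs_mult mult_ac)
  finally show ?thesis .
qed

lemma bernstein_comb_error:
  assumes "cmod z \<le> R" "1 \<le> R" "0 < m"
  shows "cmod (lin_comb character (bernstein_comb p v m z) \<xi>
      - character p \<xi> * exp (z * (\<i> * of_real (- 2 * pi * (v \<bullet> \<xi>)))))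
    \<le> 4 / real m * exp (4 * pi * R * norm v * norm \<xi>)"
proof -
  have "cmod (lin_comb character (bernstein_comb p v m z) \<xi>
      - character p \<xi> * exp (z * (\<i> * of_real (- 2 * pi * (v \<bullet> \<xi>)))))
      \<le> 4 / real m * exp (2 * R * \<bar>- 2 * pi * (v \<bullet> \<xi>)\<bar>)"
    unfolding lin_comb_character_bernstein[OF assms(3)] right_diff_distrib[symmetric]
      norm_mult norm_character
    using bernstein_exp_error[OF assms, of "- 2 * pi * (v \<bullet> \<xi>)"] by simp
  also have "\<dots> \<le> 4 / real m * exp (4 * pi * R * norm v * norm \<xi>)"
    using mult_left_mono[OF Cauchy_Schwarz_ineq2[of v \<xi>], of "4 * pi * R"] assms
    by (intro mult_left_mono) (auto simp: abs_mult mult_ac)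
  finally show ?thesis .
qed

locale fourier_composition =
  dom: fourier_rkhs E k H ip M + cod: fourier_rkhs U k H' ip' M
    + bounded_composition E k H ip U k H' ip' f K
  for E :: "'a::euclidean_space set" and k H ip M U H' ip' f K
begin

text \<open>
  The adjoint is bounded, and the source norm is controlled by the characters: formal combinations
  that are close on the Fourier side have close targets.
\<close>

lemma target_lipschitz:
  assumes "snd ` set ps \<subseteq> U" "snd ` set qs \<subseteq> U" "0 \<le> C"
    and "\<And>\<xi>. cmod (lin_comb character ps \<xi> - lin_comb character qs \<xi>) \<le> C * exp (a * norm \<xi>)"
  shows "ip_norm ip (\<lambda>y. target ps y - target qs y)
    \<le> K * (C * sqrt (dom.exp_L1 (2 * a)))"
proof -
  have ps: "snd ` set (diff_comb ps qs) \<subseteq> U" using assms(1,2) by simp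
  have "ip_norm ip' (source (diff_comb ps qs)) \<le> C * sqrt (dom.exp_L1 (2 * a))"
    using assms by (intro cod.ip_norm_lin_comb_le) (auto simp: lin_comb_diff)
  then show ?thesis
    using target_norm_le[OF ps] bound_nonneg
    unfolding lin_comb_diff by (meson mult_left_mono order_trans)
qed

lemma target_bound:
  assumes "snd ` set ps \<subseteq> U" "0 \<le> C"
    and "\<And>\<xi>. cmod (lin_comb character ps \<xi>) \<le> C * exp (a * norm \<xi>)"
  shows "ip_norm ip (target ps) \<le> K * (C * sqrt (dom.exp_L1 (2 * a)))"
  using target_lipschitz[of ps "[]" C a] assms by (simp add: lin_comb_Nil)

context
  fixes p v :: 'a
  assumes segment: "\<And>s. 0 \<le> s \<Longrightarrow> s \<le> 1 \<Longrightarrow> p + s *\<^sub>R v \<in> U"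
begin

abbreviation "curve m z \<equiv> target (bernstein_comb p v (Suc m) z)"

text \<open>
  Conjugating the argument of the second factor makes this polynomial in \<open>z\<close>, as the inner product is
  conjugate linear there; for real \<open>z\<close> it is the squared norm of \<open>curve m z\<close>.
\<close>

definition energy :: "nat \<Rightarrow> complex \<Rightarrow> complex" where
  "energy m z = ip (curve m z) (curve m (cnj z))"

lemma points: "snd ` set (bernstein_comb p v (Suc m) z) \<subseteq> U"
  using segment by (intro points_bernstein_comb) auto

lemma curve_in: "curve m z \<in> H"
  by (intro target_in points)

definition curve_bound :: "real \<Rightarrow> real" where
  "curve_bound R = K * sqrt (dom.exp_L1 (2 * (2 * pi * R * norm v)))"

definition curve_error :: "real \<Rightarrow> real" where
  "curve_error R = 4 * K * sqrt (dom.exp_L1 (2 * (4 * pi * R * norm v)))"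

lemma curve_bound_nonneg: "0 \<le> curve_bound R"
  using bound_nonneg by (simp add: curve_bound_def dom.exp_L1_nonneg)

lemma curve_error_nonneg: "0 \<le> curve_error R"
  using bound_nonneg by (simp add: curve_error_def dom.exp_L1_nonneg)

lemma curve_norm_le:
  assumes "cmod z \<le> R"
  shows "ip_norm ip (curve m z) \<le> curve_bound R"
proof -
  have "cmod (lin_comb character (bernstein_comb p v (Suc m) z) \<xi>)
      \<le> 1 * exp (2 * pi * R * norm v * norm \<xi>)" for \<xi>
    unfolding mult_1 by (rule bernstein_comb_bound[OF assms zero_less_Suc])
  from target_bound[OF points _ this] show ?thesis by (simp add: curve_bound_def)
qed

lemma curve_diff_le:
  assumes z: "cmod z \<le> R" "1 \<le> R" and "L \<le> m" "L \<le> n"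
  shows "ip_norm ip (\<lambda>y. curve m z y - curve n z y) \<le> 2 * curve_error R / real (Suc L)"
proof -
  have "cmod (lin_comb character (bernstein_comb p v (Suc m) z) \<xi>
      - lin_comb character (bernstein_comb p v (Suc n) z) \<xi>)
      \<le> 8 / real (Suc L) * exp (4 * pi * R * norm v * norm \<xi>)" for \<xi>
  proof -
    let ?e = "exp (4 * pi * R * norm v * norm \<xi>)"
    let ?x = "character p \<xi> * exp (z * (\<i> * of_real (- 2 * pi * (v \<bullet> \<xi>))))"
    have *: "cmod (lin_comb character (bernstein_comb p v (Suc i) z) \<xi> - ?x)
        \<le> 4 / real (Suc L) * ?e" if "L \<le> i" for i
    proof (rule order_trans[OF bernstein_comb_error[OF z]])
      show "4 / real (Suc i) * ?e \<le> 4 / real (Suc L) * ?e"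
        using that by (intro mult_right_mono divide_left_mono) auto
    qed simp
    have "8 / real (Suc L) * ?e = 4 / real (Suc L) * ?e + 4 / real (Suc L) * ?e" by simp
    then show ?thesis
      using *[OF assms(3)] *[OF assms(4)]
        norm_triangle_ineq4[of "lin_comb character (bernstein_comb p v (Suc m) z) \<xi> - ?x"
          "lin_comb character (bernstein_comb p v (Suc n) z) \<xi> - ?x"]
      by simp
  qed
  from target_lipschitz[OF points points _ this] show ?thesis
    by (simp add: curve_error_def mult_ac)
qed

lemma energy_diff_le:
  assumes z: "cmod z \<le> R" "1 \<le> R" and "L \<le> m" "L \<le> n"
  shows "cmod (energy m z - energy n z) \<le> 4 * curve_bound R * curve_error R / real (Suc L)"
proof -
  let ?A = "curve m z" and ?A' = "curve m (cnj z)" and ?B = "curve n z" and ?B' = "curve n (cnj z)"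
  have z': "cmod (cnj z) \<le> R" using z by simp
  have d: "(\<lambda>y. ?A y - ?B y) \<in> H" "(\<lambda>y. ?A' y - ?B' y) \<in> H"
    using curve_in by (auto intro: dom.diff_closed)
  have "cmod (energy m z - energy n z)
      = cmod (ip (\<lambda>y. ?A y - ?B y) ?A' + ip ?B (\<lambda>y. ?A' y - ?B' y))"
    using curve_in by (simp add: energy_def dom.ip_diff_left dom.ip_diff_right)
  also have "\<dots> \<le> cmod (ip (\<lambda>y. ?A y - ?B y) ?A') + cmod (ip ?B (\<lambda>y. ?A' y - ?B' y))"
    by (rule norm_triangle_ineq)
  also have "\<dots> \<le> ip_norm ip (\<lambda>y. ?A y - ?B y) * ip_norm ip ?A'
      + ip_norm ip ?B * ip_norm ip (\<lambda>y. ?A' y - ?B' y)"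
    using d curve_in by (intro add_mono dom.Cauchy_Schwarz)
  also have "\<dots> \<le> 2 * curve_error R / real (Suc L) * curve_bound R
      + curve_bound R * (2 * curve_error R / real (Suc L))"
    using d curve_in curve_norm_le[OF z(1)] curve_norm_le[OF z'] curve_bound_nonneg[of R]
      curve_error_nonneg[of R] curve_diff_le[OF z assms(3,4)] curve_diff_le[OF z' z(2) assms(3,4)]
    by (intro add_mono mult_mono dom.ip_norm_nonneg) auto
  finally show ?thesis by (simp add: mult_ac)
qed

lemma energy_holomorphic: "energy m holomorphic_on UNIV"
proof -
  let ?B = "\<lambda>j z. of_nat (Suc m choose j) * z ^ j * (1 - z) ^ (Suc m - j) :: complex"
  let ?h = "\<lambda>j. kernel_section E k (f (p + (real j / real (Suc m)) *\<^sub>R v))"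
  have h: "?h j \<in> H" if "j \<le> Suc m" for j
    using maps segment[of "real j / real (Suc m)"] that
    by (intro dom.section_in) (auto simp: field_simps)
  have "energy m z = (\<Sum>i\<le>Suc m. ?B i z * (\<Sum>j\<le>Suc m. ?B j z * ip (?h i) (?h j)))" for z
  proof -
    have curve: "curve m z = (\<lambda>y. \<Sum>j\<le>Suc m. ?B j z * ?h j y)" for z
      by (intro ext lin_comb_bernstein)
    have sum: "(\<lambda>y. \<Sum>j\<le>Suc m. ?B j z * ?h j y) \<in> H" for z
      using h by (intro dom.sum_closed) auto
    have "energy m z = (\<Sum>i\<le>Suc m. ?B i z * ip (?h i) (\<lambda>y. \<Sum>j\<le>Suc m. ?B j (cnj z) * ?h j y))"
      unfolding energy_def curve using h by (intro dom.ip_sum_left sum) auto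
    also have "\<dots> = (\<Sum>i\<le>Suc m. ?B i z * (\<Sum>j\<le>Suc m. cnj (?B j (cnj z)) * ip (?h i) (?h j)))"
      using h
      by (intro sum.cong refl arg_cong2[of _ _ _ _ "(*)"] dom.ip_sum_right) auto
    finally show ?thesis by (simp del: sum.atMost_Suc)
  qed
  then have "energy m = (\<lambda>z. \<Sum>i\<le>Suc m. ?B i z * (\<Sum>j\<le>Suc m. ?B j z * ip (?h i) (?h j)))"
    by blast
  then show ?thesis by (auto intro!: holomorphic_intros simp del: sum.atMost_Suc)
qed

lemma energy_real: "energy m (of_real t) = of_real ((ip_norm ip (curve m (of_real t)))\<^sup>2)"
  by (simp add: energy_def dom.ip_self[OF curve_in])

text \<open>
  At a real \<open>t \<in> [0, 1]\<close> the curve converges to the kernel section of \<open>f (p + t v)\<close>, and every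
  kernel section has squared norm \<open>mass\<close>.
\<close>

lemma energy_limit_on_segment:
  assumes t: "0 \<le> t" "t \<le> 1"
  shows "(\<lambda>m. energy m (of_real t)) \<longlonglongrightarrow> of_real dom.mass"
proof -
  let ?h = "kernel_section E k (f (p + t *\<^sub>R v))"
  have U: "snd ` set [(1::complex, p + t *\<^sub>R v)] \<subseteq> U" using segment[OF t] by simp
  have fE: "f (p + t *\<^sub>R v) \<in> E" using segment[OF t] maps by blast
  have h: "?h \<in> H" by (rule dom.section_in[OF fE])
  have dist: "ip_norm ip (\<lambda>y. curve m (of_real t) y - ?h y) \<le> curve_error 1 / real (Suc m)" for m
  proof -
    have "cmod (lin_comb character (bernstein_comb p v (Suc m) (of_real t)) \<xi>
        - lin_comb character [(1, p + t *\<^sub>R v)] \<xi>)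
        \<le> 4 / real (Suc m) * exp (4 * pi * 1 * norm v * norm \<xi>)" for \<xi>
      unfolding lin_comb_single character_add character_scaleR
      using t by (intro bernstein_comb_error) auto
    from target_lipschitz[OF points U _ this] show ?thesis
      by (simp add: curve_error_def lin_comb_single mult_ac)
  qed
  have "(\<lambda>m. ip_norm ip (curve m (of_real t)) - sqrt dom.mass) \<longlonglongrightarrow> 0"
  proof (rule Lim_null_comparison)
    show "\<forall>\<^sub>F m in sequentially. norm (ip_norm ip (curve m (of_real t)) - sqrt dom.mass)
        \<le> curve_error 1 / real (Suc m)"
    proof (intro always_eventually allI)
      fix m
      show "norm (ip_norm ip (curve m (of_real t)) - sqrt dom.mass) \<le> curve_error 1 / real (Suc m)"
        using dom.ip_norm_diff_ge[OF curve_in h, of m "of_real t"] dist[of m]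
        unfolding dom.ip_norm_section[OF fE] real_norm_def by (rule order_trans)
    qed
    show "(\<lambda>m. curve_error 1 / real (Suc m)) \<longlonglongrightarrow> 0"
      by (rule LIMSEQ_Suc[OF lim_const_over_n])
  qed
  then have "(\<lambda>m. ip_norm ip (curve m (of_real t))) \<longlonglongrightarrow> sqrt dom.mass"
    by (simp add: LIM_zero_iff)
  then have "(\<lambda>m. of_real ((ip_norm ip (curve m (of_real t)))\<^sup>2) :: complex)
      \<longlonglongrightarrow> of_real ((sqrt dom.mass)\<^sup>2)"
    by (intro tendsto_intros)
  then show ?thesis by (simp add: energy_real dom.mass_def del: of_real_power)
qed

lemma energy_uniformly_Cauchy:
  assumes "1 \<le> R"
  shows "uniformly_Cauchy_on (cball 0 R) energy"
proof (rule uniformly_Cauchy_onI)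
  fix e :: real assume "0 < e"
  let ?D = "4 * curve_bound R * curve_error R"
  have "(\<lambda>L. ?D / real (Suc L)) \<longlonglongrightarrow> 0" by (rule LIMSEQ_Suc[OF lim_const_over_n])
  then have "\<forall>\<^sub>F L in sequentially. ?D / real (Suc L) < e"
    using \<open>0 < e\<close> by (rule order_tendstoD)
  then obtain L where L: "?D / real (Suc L) < e"
    unfolding eventually_sequentially by blast
  have "dist (energy m z) (energy n z) < e" if "z \<in> cball 0 R" "L \<le> m" "L \<le> n" for z m n
    using energy_diff_le[of z R L m n] that assms L by (simp add: dist_norm)
  then show "\<exists>L. \<forall>z\<in>cball 0 R. \<forall>m\<ge>L. \<forall>n\<ge>L. dist (energy m z) (energy n z) < e" by blast
qed

text \<open>
  The energies converge locally uniformly to an entire function, which is constant on \<open>[0, 1]\<close> and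
  therefore constant.  For real \<open>z\<close> outside \<open>[0, 1]\<close> this bounds the targets away from \<open>0\<close> far
  out on the line, where nothing is known about \<open>f\<close>.
\<close>

lemma energy_limit: "(\<lambda>m. energy m z) \<longlonglongrightarrow> of_real dom.mass"
proof -
  define g where "g z = lim (\<lambda>m. energy m z)" for z
  have unif: "uniform_limit (cball 0 R) energy g sequentially" if "1 \<le> R" for R
    using Cauchy_uniformly_convergent[OF energy_uniformly_Cauchy[OF that]]
    unfolding uniformly_convergent_uniform_limit_iff g_def .
  have lim: "(\<lambda>m. energy m z) \<longlonglongrightarrow> g z" for z
    by (rule tendsto_uniform_limitI[OF unif[of "max 1 (cmod z)"]]) auto
  have "g holomorphic_on UNIV"
  proof (rule holomorphic_uniform_sequence[OF open_UNIV energy_holomorphic])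
    fix z :: complex
    have "cball z 1 \<subseteq> cball 0 (cmod z + 1)"
      by (simp add: cball_subset_cball_iff dist_norm)
    then have "uniform_limit (cball z 1) energy g sequentially"
      by (intro uniform_limit_on_subset[OF unif[of "cmod z + 1"]]) auto
    then show "\<exists>d>0. cball z d \<subseteq> UNIV \<and> uniform_limit (cball z d) energy g sequentially"
      by (intro exI[of _ 1]) auto
  qed
  then have "(\<lambda>z. g z - of_real dom.mass) holomorphic_on UNIV" by (intro holomorphic_intros)
  moreover have "(0::complex) islimpt of_real ` {0..1::real}"
    unfolding islimpt_approachable
  proof (intro allI impI)
    fix e :: real assume "0 < e"
    then show "\<exists>x'\<in>of_real ` {0..1::real}. x' \<noteq> 0 \<and> dist x' (0::complex) < e"
      by (intro bexI[of _ "of_real (min 1 (e / 2))"]) (auto simp: min_def)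
  qed
  moreover have "g z - of_real dom.mass = 0" if "z \<in> of_real ` {0..1::real}" for z
    using that LIMSEQ_unique[OF lim energy_limit_on_segment] by auto
  ultimately have "g z - of_real dom.mass = 0"
    by (rule analytic_continuation[OF _ open_UNIV connected_UNIV subset_UNIV UNIV_I _ _ UNIV_I])
  then show ?thesis using lim[of z] by simp
qed

text \<open>
  The sources approximate the kernel section of the point \<open>p + t v\<close> uniformly on \<open>U\<close>, for any real
  \<open>t\<close>; their values at \<open>y\<close> thus become values of the Fourier transform far from the origin.
\<close>

lemma source_eval_error:
  assumes y: "y \<in> U" and t: "\<bar>t\<bar> \<le> R" "1 \<le> R"
  shows "cmod (source (bernstein_comb p v (Suc m) (of_real t)) y
      - (\<integral>\<xi>. character (p - y + t *\<^sub>R v) \<xi> \<partial>M))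
    \<le> 4 / real (Suc m) * dom.exp_L1 (4 * pi * R * norm v)"
proof -
  let ?F = "lin_comb character (bernstein_comb p v (Suc m) (of_real t))"
  let ?G = "character (p + t *\<^sub>R v)"
  have ch: "character (p - y + t *\<^sub>R v) \<xi> = ?G \<xi> * cnj (character y \<xi>)" for \<xi>
  proof -
    have "p - y + t *\<^sub>R v = (p + t *\<^sub>R v) - y" by simp
    then show ?thesis by (simp only: character_diff)
  qed
  have F: "integrable M (\<lambda>\<xi>. ?F \<xi> * cnj (character y \<xi>))"
    by (rule dom.integrable_lin_comb_character[where C = 1]) (auto simp: norm_character)
  have G: "integrable M (\<lambda>\<xi>. ?G \<xi> * cnj (character y \<xi>))"
    using dom.integrable_lin_comb_character[of "\<lambda>\<xi>. cnj (character y \<xi>)" 1 "[(1, p + t *\<^sub>R v)]"]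
    by (simp add: norm_character lin_comb_single)
  have "source (bernstein_comb p v (Suc m) (of_real t)) y - (\<integral>\<xi>. character (p - y + t *\<^sub>R v) \<xi> \<partial>M)
      = (\<integral>\<xi>. ?F \<xi> * cnj (character y \<xi>) - ?G \<xi> * cnj (character y \<xi>) \<partial>M)"
    unfolding cod.lin_comb_eval[OF y] ch
    using Bochner_Integration.integral_diff[OF F G] by simp
  also have "cmod \<dots> \<le> 4 / real (Suc m) * dom.exp_L1 (4 * pi * R * norm v)"
  proof (rule dom.integrable_exp_bounded(2))
    fix \<xi>
    have "cmod (?F \<xi> * cnj (character y \<xi>) - ?G \<xi> * cnj (character y \<xi>)) = cmod (?F \<xi> - ?G \<xi>)"
      by (simp add: left_diff_distrib[symmetric] norm_mult norm_character)
    also have "\<dots> \<le> 4 / real (Suc m) * exp (4 * pi * R * norm v * norm \<xi>)"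
      unfolding character_add character_scaleR using t by (intro bernstein_comb_error) auto
    finally show "cmod (?F \<xi> * cnj (character y \<xi>) - ?G \<xi> * cnj (character y \<xi>))
        \<le> 4 / real (Suc m) * exp (4 * pi * R * norm v * norm \<xi>)" .
  qed measurable
  finally show ?thesis .
qed

text \<open>
  The integrand on the Fourier side is at most \<open>(1 + error)\<^sup>2 \<le> 2 + 2 error\<^sup>2\<close>, so for \<open>m\<close> large,
  depending on \<open>t\<close>, the source norms are bounded independently of \<open>t\<close>.
\<close>

lemma source_norm_le:
  assumes t: "\<bar>t\<bar> \<le> R" "1 \<le> R"
  shows "(ip_norm ip' (source (bernstein_comb p v (Suc m) (of_real t))))\<^sup>2
    \<le> 2 * dom.mass + 32 / (real (Suc m))\<^sup>2 * dom.exp_L1 (8 * pi * R * norm v)"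
proof -
  let ?F = "lin_comb character (bernstein_comb p v (Suc m) (of_real t))"
  let ?W = "\<lambda>\<xi>. exp (8 * pi * R * norm v * norm \<xi>)"
  have bound: "(cmod (?F \<xi>))\<^sup>2 \<le> 2 + 32 / (real (Suc m))\<^sup>2 * ?W \<xi>" for \<xi>
  proof -
    let ?G = "character (p + t *\<^sub>R v) \<xi>"
    have err: "cmod (?F \<xi> - ?G) \<le> 4 / real (Suc m) * exp (4 * pi * R * norm v * norm \<xi>)"
      unfolding character_add character_scaleR using t by (intro bernstein_comb_error) auto
    have "cmod (?F \<xi>) \<le> 1 + cmod (?F \<xi> - ?G)"
      using norm_triangle_ineq[of ?G "?F \<xi> - ?G"] by (simp add: norm_character)
    then have "(cmod (?F \<xi>))\<^sup>2 \<le> (1 + cmod (?F \<xi> - ?G))\<^sup>2" by (intro power_mono) auto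
    also have "\<dots> \<le> 2 + 2 * (cmod (?F \<xi> - ?G))\<^sup>2"
      using zero_le_power2[of "1 - cmod (?F \<xi> - ?G)"] by (simp add: power2_eq_square algebra_simps)
    also have "(cmod (?F \<xi> - ?G))\<^sup>2 \<le> (4 / real (Suc m) * exp (4 * pi * R * norm v * norm \<xi>))\<^sup>2"
      using err by (intro power_mono) auto
    also have "\<dots> = 16 / (real (Suc m))\<^sup>2 * ?W \<xi>"
      by (simp add: power_mult_distrib power_divide exp_double[symmetric] del: of_nat_Suc)
    finally show ?thesis by (simp del: of_nat_Suc)
  qed
  have "integrable M (\<lambda>\<xi>. ?F \<xi> * cnj (?F \<xi>))"
    using dom.norm_lin_comb_character_le by (intro dom.integrable_lin_comb_character) auto
  then have int: "integrable M (\<lambda>\<xi>. (cmod (?F \<xi>))\<^sup>2)"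
    by (drule_tac integrable_Re) (simp add: complex_norm_square[symmetric] del: of_real_power)
  have W: "integrable M (\<lambda>\<xi>. 32 / (real (Suc m))\<^sup>2 * ?W \<xi>)"
    by (intro integrable_mult_right dom.exp_moment)
  have "complex_of_real ((ip_norm ip' (source (bernstein_comb p v (Suc m) (of_real t))))\<^sup>2)
      = of_real (\<integral>\<xi>. (cmod (?F \<xi>))\<^sup>2 \<partial>M)"
    unfolding cod.ip_self[OF source_in[OF points], symmetric] cod.ip_lin_comb[OF points points]
    by (simp add: complex_norm_square[symmetric] del: of_real_power)
  then have "(ip_norm ip' (source (bernstein_comb p v (Suc m) (of_real t))))\<^sup>2
      = (\<integral>\<xi>. (cmod (?F \<xi>))\<^sup>2 \<partial>M)"
    by (simp only: of_real_eq_iff)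
  also have "\<dots> \<le> (\<integral>\<xi>. 2 + 32 / (real (Suc m))\<^sup>2 * ?W \<xi> \<partial>M)"
    using int W bound by (intro integral_mono) auto
  also have "\<dots> = 2 * dom.mass + 32 / (real (Suc m))\<^sup>2 * dom.exp_L1 (8 * pi * R * norm v)"
    using W by (simp add: dom.mass_def dom.exp_L1_def mult.commute del: of_nat_Suc)
  finally show ?thesis .
qed

end
end

section \<open>The Riemann--Lebesgue lemma\<close>

lemma power_le_fact_exp:
  fixes x :: real
  assumes "0 \<le> x"
  shows "x ^ n \<le> fact n * exp x"
proof -
  have "(\<Sum>i\<in>{n}. x ^ i /\<^sub>R fact i) \<le> exp x"
    unfolding exp_def using assms by (intro sum_le_suminf summable_exp_generic) auto
  then show ?thesis by (simp add: field_simps)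
qed

text \<open>
  On the shell \<open>n \<le> |x| < n + 1\<close> the function is at most \<open>exp (- n)\<close>, and the ball of radius
  \<open>n + 1\<close> has volume polynomial in \<open>n\<close>.
\<close>

lemma integrable_exp_minus_norm:
  "integrable lborel (\<lambda>x::'a::euclidean_space. exp (- norm x))"
proof -
  define d where "d = DIM('a)"
  define c where "c n = exp (- real n) * (unit_ball_vol d * real (Suc n) ^ d)" for n
  have c_nonneg: "0 \<le> c n" for n by (simp add: c_def)
  have "summable c"
  proof (rule summable_comparison_test')
    have "exp (- (1/2)) < (1::real)" by simp
    then show "summable (\<lambda>n. unit_ball_vol d * (2 ^ d * fact d * exp (1/2)) * exp (- (1/2)) ^ n)"
      by (intro summable_mult summable_geometric) simp
  next
    fix n :: nat assume "0 \<le> n"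
    have "real (Suc n) ^ d = 2 ^ d * (real (Suc n) / 2) ^ d" by (simp add: power_divide)
    also have "\<dots> \<le> 2 ^ d * (fact d * exp (real (Suc n) / 2))"
      by (intro mult_left_mono power_le_fact_exp) auto
    finally have "c n \<le> exp (- real n) * (unit_ball_vol d * (2 ^ d * (fact d * exp (real (Suc n) / 2))))"
      unfolding c_def by (intro mult_left_mono) auto
    also have "\<dots> = unit_ball_vol d * (2 ^ d * fact d) * (exp (- real n) * exp (real (Suc n) / 2))"
      by simp
    also have "exp (- real n) * exp (real (Suc n) / 2) = exp (1/2) * exp (- (1/2)) ^ n"
      by (simp add: exp_of_nat_mult[symmetric] exp_add[symmetric] field_simps)
    finally show "norm (c n) \<le> unit_ball_vol d * (2 ^ d * fact d * exp (1/2)) * exp (- (1/2)) ^ n"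
      using c_nonneg by (simp add: mult_ac)
  qed
  have le: "ennreal (exp (- norm x)) \<le> (\<Sum>n. ennreal (exp (- real n)) * indicator (ball 0 (real (Suc n))) x)"
    for x :: 'a
  proof -
    define n where "n = nat \<lfloor>norm x\<rfloor>"
    have n: "real n \<le> norm x" "norm x < real (Suc n)"
      by (auto simp: n_def) linarith
    define F :: "nat \<Rightarrow> ennreal"
      where "F i = ennreal (exp (- real i)) * indicator (ball 0 (real (Suc i))) x" for i
    have "ennreal (exp (- norm x)) \<le> F n"
      using n by (simp add: F_def ennreal_leI del: of_nat_Suc)
    also have "\<dots> \<le> (\<Sum>i. F i)"
      using sum_le_suminf[of F "{n}"] by simp
    finally show ?thesis unfolding F_def .
  qed
  have "(\<integral>\<^sup>+x. ennreal (exp (- norm (x::'a))) \<partial>lborel)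
      \<le> (\<integral>\<^sup>+x. (\<Sum>n. ennreal (exp (- real n)) * indicator (ball 0 (real (Suc n))) (x::'a)) \<partial>lborel)"
    using le by (intro nn_integral_mono)
  also have "\<dots> = (\<Sum>n. \<integral>\<^sup>+x. ennreal (exp (- real n)) * indicator (ball 0 (real (Suc n))) (x::'a) \<partial>lborel)"
    by (intro nn_integral_suminf borel_measurable_times_ennreal borel_measurable_indicator) auto
  also have "\<dots> = (\<Sum>n. ennreal (c n))"
    by (simp add: nn_integral_cmult_indicator emeasure_ball c_def d_def ennreal_mult del: of_nat_Suc)
  also have "\<dots> < \<infinity>"
    using \<open>summable c\<close> c_nonneg by (simp add: suminf_ennreal2)
  finally show ?thesis by (intro integrableI_bounded) auto
qed

lemma integrable_shift_lborel:
  fixes g :: "'a::euclidean_space \<Rightarrow> 'b::{banach, second_countable_topology}"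
  assumes "integrable lborel g"
  shows "integrable lborel (\<lambda>x. g (a + x))" "(\<integral>x. g (a + x) \<partial>lborel) = (\<integral>x. g x \<partial>lborel)"
proof -
  have g: "g \<in> borel_measurable borel" using assms by (auto dest: borel_measurable_integrable)
  have "integrable (distr lborel borel ((+) a)) g" using assms by (simp add: lborel_distr_plus)
  then show "integrable lborel (\<lambda>x. g (a + x))" using g by (subst (asm) integrable_distr_eq) auto
  have "(\<integral>x. g x \<partial>lborel) = (\<integral>x. g x \<partial>distr lborel borel ((+) a))" by (simp add: lborel_distr_plus)
  also have "\<dots> = (\<integral>x. g (a + x) \<partial>lborel)" using g by (subst integral_distr) auto
  finally show "(\<integral>x. g (a + x) \<partial>lborel) = (\<integral>x. g x \<partial>lborel)" ..
qed

definition clamp_to :: "real \<Rightarrow> real \<Rightarrow> real" where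
  "clamp_to b t = max (- b) (min b t)"

lemma abs_clamp_to: "0 \<le> b \<Longrightarrow> \<bar>clamp_to b t\<bar> \<le> b"
  by (auto simp: clamp_to_def)

lemma clamp_to_le: "0 \<le> b \<Longrightarrow> \<bar>clamp_to b t\<bar> \<le> \<bar>t\<bar>"
  by (auto simp: clamp_to_def max_def min_def)

lemma clamp_to_eq: "\<bar>t\<bar> \<le> b \<Longrightarrow> clamp_to b t = t"
  by (auto simp: clamp_to_def)

text \<open>
  Truncating \<open>w\<close> at \<open>n exp (- |x|)\<close> changes it little in \<open>L\<^sup>1\<close> for large \<open>n\<close>.  A measurable function is
  an almost everywhere limit of continuous ones, and truncating these at the same level provides an
  integrable majorant for dominated convergence.
\<close>

lemma continuous_dense_L1:
  fixes w :: "'a::euclidean_space \<Rightarrow> real"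
  assumes w: "integrable lebesgue w" and "0 < e"
  shows "\<exists>g C. continuous_on UNIV g \<and> (\<forall>x. \<bar>g x\<bar> \<le> C * exp (- norm x)) \<and>
    integrable lebesgue g \<and> (\<integral>x. \<bar>w x - g x\<bar> \<partial>lebesgue) < e"
proof -
  let ?m = "\<lambda>n x. real n * exp (- norm (x::'a))"
  let ?W = "\<lambda>n x. clamp_to (?m n x) (w x)"
  have wm [measurable]: "w \<in> borel_measurable lebesgue" using w by auto
  have mm [measurable]: "?m n \<in> borel_measurable lebesgue" for n
    by (intro measurable_completion) measurable
  have m_int: "integrable lebesgue (?m n)" for n
    by (intro integrable_mult_right) (simp add: integrable_completion integrable_exp_minus_norm)
  have "(\<lambda>n. \<integral>x. \<bar>w x - ?W n x\<bar> \<partial>lebesgue) \<longlonglongrightarrow> (\<integral>x. 0 \<partial>(lebesgue :: 'a measure))"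
  proof (rule integral_dominated_convergence)
    show "AE x in lebesgue. norm \<bar>w x - ?W n x\<bar> \<le> 2 * \<bar>w x\<bar>" for n
    proof (rule AE_I2)
      fix x show "norm \<bar>w x - ?W n x\<bar> \<le> 2 * \<bar>w x\<bar>"
        using clamp_to_le[of "?m n x" "w x"] by simp
    qed
    show "AE x in lebesgue. (\<lambda>n. \<bar>w x - ?W n x\<bar>) \<longlonglongrightarrow> 0"
    proof (rule AE_I2)
      fix x
      obtain n0 where n0: "\<bar>w x\<bar> / exp (- norm x) \<le> real n0" using real_arch_simple by blast
      have "\<bar>w x - ?W n x\<bar> = 0" if "n \<ge> n0" for n
      proof -
        have "\<bar>w x\<bar> \<le> real n0 * exp (- norm x)" using n0 by (simp add: field_simps)
        also have "\<dots> \<le> ?m n x" using that by (intro mult_right_mono) auto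
        finally show ?thesis by (simp add: clamp_to_eq)
      qed
      then show "(\<lambda>n. \<bar>w x - ?W n x\<bar>) \<longlonglongrightarrow> 0"
        by (intro tendsto_eventually) (auto simp: eventually_sequentially)
    qed
  qed (use w in \<open>auto simp: clamp_to_def\<close>)
  then have "\<forall>\<^sub>F n in sequentially. (\<integral>x. \<bar>w x - ?W n x\<bar> \<partial>lebesgue) < e / 2"
    using \<open>0 < e\<close> by (intro order_tendstoD) auto
  then obtain n where n: "(\<integral>x. \<bar>w x - ?W n x\<bar> \<partial>lebesgue) < e / 2"
    unfolding eventually_sequentially by blast
  obtain N G where N: "negligible N" and G: "\<And>i. continuous_on UNIV (G i)"
    and lim: "\<And>x. x \<notin> N \<Longrightarrow> (\<lambda>i. G i x) \<longlonglongrightarrow> w x"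
    using lebesgue_measurable_imp_measurable_on_real[OF wm, of UNIV] unfolding measurable_on_def by auto
  let ?g = "\<lambda>i x. clamp_to (?m n x) (G i x)"
  have cont: "continuous_on UNIV (?g i)" for i
    unfolding clamp_to_def using G by (intro continuous_intros) auto
  have gm [measurable]: "?g i \<in> borel_measurable lebesgue" for i
    using borel_measurable_continuous_onI[OF cont] by (intro measurable_completion) simp
  have g_le: "\<bar>?g i x\<bar> \<le> ?m n x" for i x by (intro abs_clamp_to) simp
  have W_le: "\<bar>?W n x\<bar> \<le> ?m n x" for x by (intro abs_clamp_to) simp
  have g_int: "integrable lebesgue (?g i)" for i
    by (rule Bochner_Integration.integrable_bound[OF m_int[of n] gm]) (use g_le in auto)
  have W_meas [measurable]: "?W n \<in> borel_measurable lebesgue"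
    unfolding clamp_to_def by measurable
  have W_int: "integrable lebesgue (?W n)"
    by (rule Bochner_Integration.integrable_bound[OF m_int[of n] W_meas]) (use W_le in auto)
  have "(\<lambda>i. \<integral>x. \<bar>?W n x - ?g i x\<bar> \<partial>lebesgue) \<longlonglongrightarrow> (\<integral>x. 0 \<partial>(lebesgue :: 'a measure))"
  proof (rule integral_dominated_convergence)
    show "integrable lebesgue (\<lambda>x. 2 * ?m n x)" by (intro integrable_mult_right m_int)
    show "AE x in lebesgue. norm \<bar>?W n x - ?g i x\<bar> \<le> 2 * ?m n x" for i
    proof (rule AE_I2)
      fix x show "norm \<bar>?W n x - ?g i x\<bar> \<le> 2 * ?m n x"
        using W_le[of x] g_le[of x i] abs_triangle_ineq4[of "?W n x" "?g i x"] by simp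
    qed
    show "AE x in lebesgue. (\<lambda>i. \<bar>?W n x - ?g i x\<bar>) \<longlonglongrightarrow> 0"
    proof (rule AE_I')
      show "N \<in> null_sets lebesgue" using N by (simp add: negligible_iff_null_sets)
      have "(\<lambda>i. \<bar>?W n x - ?g i x\<bar>) \<longlonglongrightarrow> \<bar>?W n x - ?W n x\<bar>" if "x \<notin> N" for x
        unfolding clamp_to_def using lim[OF that] by (intro tendsto_intros)
      then show "{x \<in> space lebesgue. \<not> (\<lambda>i. \<bar>?W n x - ?g i x\<bar>) \<longlonglongrightarrow> 0} \<subseteq> N" by auto
    qed
  qed auto
  then have "\<forall>\<^sub>F i in sequentially. (\<integral>x. \<bar>?W n x - ?g i x\<bar> \<partial>lebesgue) < e / 2"
    using \<open>0 < e\<close> by (intro order_tendstoD) auto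
  then obtain i where i: "(\<integral>x. \<bar>?W n x - ?g i x\<bar> \<partial>lebesgue) < e / 2"
    unfolding eventually_sequentially by blast
  have "(\<integral>x. \<bar>w x - ?g i x\<bar> \<partial>lebesgue)
      \<le> (\<integral>x. \<bar>w x - ?W n x\<bar> + \<bar>?W n x - ?g i x\<bar> \<partial>lebesgue)"
    using w W_int g_int by (intro integral_mono) auto
  also have "\<dots> < e"
    using n i w W_int g_int by (subst Bochner_Integration.integral_add) auto
  finally show ?thesis using cont g_le g_int by blast
qed

text \<open>
  The vector \<open>\<eta> = x / (2 |x|\<^sup>2)\<close> satisfies \<open>x \<bullet> \<eta> = 1 / 2\<close>, so translation by \<open>\<eta>\<close> changes the sign
  of the character of \<open>x\<close>.  Averaging the integral with its translate replaces \<open>g\<close> by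
  \<open>(g - g (\<eta> + _)) / 2\<close>, which tends to \<open>0\<close> in \<open>L\<^sup>1\<close> as \<open>x \<rightarrow> \<infinity>\<close>.
\<close>

lemma integral_character_tendsto_0_continuous:
  fixes g :: "'a::euclidean_space \<Rightarrow> real" and X :: "nat \<Rightarrow> 'a"
  assumes cont: "continuous_on UNIV g" and bound: "\<And>x. \<bar>g x\<bar> \<le> C * exp (- norm x)"
    and X: "filterlim X at_infinity sequentially"
  shows "(\<lambda>n. \<integral>\<xi>. of_real (g \<xi>) * character (X n) \<xi> \<partial>lborel) \<longlonglongrightarrow> 0"
proof -
  have C: "0 \<le> C" using order_trans[OF abs_ge_zero bound[of 0]] by simp
  have [measurable]: "g \<in> borel_measurable borel" by (rule borel_measurable_continuous_onI[OF cont])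
  have ch [measurable]: "character x \<in> borel_measurable borel" for x :: 'a
    unfolding character_def[abs_def] by (intro borel_measurable_continuous_onI continuous_intros)
  have e_int: "integrable lborel (\<lambda>x::'a. C * exp (- norm x))"
    by (intro integrable_mult_right integrable_exp_minus_norm)
  have g_int: "integrable lborel g"
    by (rule Bochner_Integration.integrable_bound[OF e_int]) (use bound in \<open>auto intro: order_trans[OF _ abs_ge_self]\<close>)
  have gc_int: "integrable lborel (\<lambda>\<xi>. of_real (g \<xi>) * character x \<xi>)" for x
    by (rule Bochner_Integration.integrable_bound[OF g_int]) (auto simp: norm_mult norm_character)
  \<comment> \<open>the value \<open>0\<close> for short \<open>X n\<close> keeps \<open>\<eta> n\<close> in the unit ball for all \<open>n\<close>, as domination requires\<close>
  define \<eta> where "\<eta> n = (if 1 \<le> norm (X n) then (1 / (2 * (norm (X n))\<^sup>2)) *\<^sub>R X n else 0)" for n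
  have large: "\<forall>\<^sub>F n in sequentially. r \<le> norm (X n)" for r
    using X by (auto simp: filterlim_at_infinity_conv_norm_at_top filterlim_at_top)
  have norm_\<eta>: "norm (\<eta> n) = (if 1 \<le> norm (X n) then 1 / (2 * norm (X n)) else 0)" for n
    by (auto simp: \<eta>_def power2_eq_square field_simps)
  have \<eta>_le: "norm (\<eta> n) \<le> 1" for n
    using frac_le[of 1 1 1 "2 * norm (X n)"] by (auto simp: norm_\<eta>)
  have \<eta>_lim: "\<eta> \<longlonglongrightarrow> 0"
  proof (rule Lim_null_comparison)
    show "\<forall>\<^sub>F n in sequentially. norm (\<eta> n) \<le> inverse (norm (X n))"
    proof (intro always_eventually allI)
      fix n show "norm (\<eta> n) \<le> inverse (norm (X n))"
        using frac_le[of 1 1 "norm (X n)" "2 * norm (X n)"]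
        by (cases "X n = 0") (auto simp: norm_\<eta> inverse_eq_divide)
    qed
    show "(\<lambda>n. inverse (norm (X n))) \<longlonglongrightarrow> 0"
      using X by (intro tendsto_inverse_0_at_top) (simp add: filterlim_at_infinity_conv_norm_at_top)
  qed
  have shift: "cmod (\<integral>\<xi>. of_real (g \<xi>) * character (X n) \<xi> \<partial>lborel)
      \<le> (\<integral>\<xi>. \<bar>g \<xi> - g (\<eta> n + \<xi>)\<bar> \<partial>lborel)" if n: "1 \<le> norm (X n)" for n
  proof -
    let ?I = "\<integral>\<xi>. of_real (g \<xi>) * character (X n) \<xi> \<partial>lborel"
    have half: "X n \<bullet> \<eta> n = 1 / 2"
      using n by (auto simp: \<eta>_def dot_square_norm)
    have "character (X n) (\<eta> n + \<xi>) = - character (X n) \<xi>" for \<xi>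
    proof -
      have "character (X n) (\<eta> n + \<xi>) = cis (- 2 * pi * (X n \<bullet> \<eta> n)) * character (X n) \<xi>"
        by (simp add: character_def cis_mult inner_add_right algebra_simps)
      also have "cis (- 2 * pi * (X n \<bullet> \<eta> n)) = - 1"
        unfolding half by (simp add: complex_eq_iff)
      finally show ?thesis by simp
    qed
    then have "(\<integral>\<xi>. of_real (g (\<eta> n + \<xi>)) * - character (X n) \<xi> \<partial>lborel) = ?I"
      using integrable_shift_lborel(2)[OF gc_int[of "X n"], of "\<eta> n"] by simp
    moreover have s_int: "integrable lborel (\<lambda>\<xi>. of_real (g (\<eta> n + \<xi>)) * - character (X n) \<xi>)"
      using integrable_shift_lborel(1)[OF g_int, of "\<eta> n"]
      by (rule Bochner_Integration.integrable_bound) (auto simp: norm_mult norm_character)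
    ultimately have "2 * ?I = (\<integral>\<xi>. of_real (g \<xi>) * character (X n) \<xi>
        + of_real (g (\<eta> n + \<xi>)) * - character (X n) \<xi> \<partial>lborel)"
      using gc_int by simp
    also have "\<dots> = (\<integral>\<xi>. of_real (g \<xi> - g (\<eta> n + \<xi>)) * character (X n) \<xi> \<partial>lborel)"
      by (simp add: algebra_simps)
    also have "cmod \<dots> \<le> (\<integral>\<xi>. cmod (of_real (g \<xi> - g (\<eta> n + \<xi>)) * character (X n) \<xi>) \<partial>lborel)"
      by (rule integral_norm_bound)
    also have "\<dots> = (\<integral>\<xi>. \<bar>g \<xi> - g (\<eta> n + \<xi>)\<bar> \<partial>lborel)"
      unfolding norm_mult norm_character norm_of_real by simp
    finally have "cmod (2 * ?I) \<le> (\<integral>\<xi>. \<bar>g \<xi> - g (\<eta> n + \<xi>)\<bar> \<partial>lborel)" .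
    then have "2 * cmod ?I \<le> (\<integral>\<xi>. \<bar>g \<xi> - g (\<eta> n + \<xi>)\<bar> \<partial>lborel)"
      by (simp only: norm_mult norm_numeral)
    then show ?thesis using norm_ge_zero[of ?I] by linarith
  qed
  have "(\<lambda>n. \<integral>\<xi>. \<bar>g \<xi> - g (\<eta> n + \<xi>)\<bar> \<partial>lborel) \<longlonglongrightarrow> (\<integral>\<xi>. 0 \<partial>(lborel :: 'a measure))"
  proof (rule integral_dominated_convergence)
    show "integrable lborel (\<lambda>x::'a. C * (1 + exp 1) * exp (- norm x))"
      by (intro integrable_mult_right integrable_exp_minus_norm)
    show "AE \<xi> in lborel. norm \<bar>g \<xi> - g (\<eta> n + \<xi>)\<bar> \<le> C * (1 + exp 1) * exp (- norm \<xi>)" for n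
    proof (rule AE_I2)
      fix \<xi> :: 'a
      have "norm \<xi> \<le> norm (\<eta> n + \<xi>) + 1"
        using norm_triangle_ineq4[of "\<eta> n + \<xi>" "\<eta> n"] \<eta>_le[of n] by simp
      then have "exp (- norm (\<eta> n + \<xi>)) \<le> exp 1 * exp (- norm \<xi>)"
        by (simp add: exp_add[symmetric])
      then have "\<bar>g (\<eta> n + \<xi>)\<bar> \<le> C * (exp 1 * exp (- norm \<xi>))"
        using bound[of "\<eta> n + \<xi>"] C by (meson mult_left_mono order_trans)
      then show "norm \<bar>g \<xi> - g (\<eta> n + \<xi>)\<bar> \<le> C * (1 + exp 1) * exp (- norm \<xi>)"
        using bound[of \<xi>] abs_triangle_ineq4[of "g \<xi>" "g (\<eta> n + \<xi>)"]
        by (simp add: algebra_simps)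
    qed
    show "AE \<xi> in lborel. (\<lambda>n. \<bar>g \<xi> - g (\<eta> n + \<xi>)\<bar>) \<longlonglongrightarrow> 0"
    proof (rule AE_I2)
      fix \<xi> :: 'a
      have "(\<lambda>n. \<eta> n + \<xi>) \<longlonglongrightarrow> 0 + \<xi>" by (intro tendsto_intros \<eta>_lim)
      then have "(\<lambda>n. g (\<eta> n + \<xi>)) \<longlonglongrightarrow> g \<xi>"
        using continuous_on_tendsto_compose[OF cont, of "\<lambda>n. \<eta> n + \<xi>" \<xi>] by simp
      then have "(\<lambda>n. \<bar>g \<xi> - g (\<eta> n + \<xi>)\<bar>) \<longlonglongrightarrow> \<bar>g \<xi> - g \<xi>\<bar>" by (intro tendsto_intros)
      then show "(\<lambda>n. \<bar>g \<xi> - g (\<eta> n + \<xi>)\<bar>) \<longlonglongrightarrow> 0" by simp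
    qed
  qed auto
  then have lim: "(\<lambda>n. \<integral>\<xi>. \<bar>g \<xi> - g (\<eta> n + \<xi>)\<bar> \<partial>lborel) \<longlonglongrightarrow> 0" by simp
  show ?thesis
    by (rule Lim_null_comparison[OF eventually_mono[OF large[of 1] shift] lim])
qed

theorem Riemann_Lebesgue:
  fixes w :: "'a::euclidean_space \<Rightarrow> real" and X :: "nat \<Rightarrow> 'a"
  assumes w: "integrable lebesgue w" and X: "filterlim X at_infinity sequentially"
  shows "(\<lambda>n. \<integral>\<xi>. of_real (w \<xi>) * character (X n) \<xi> \<partial>lebesgue) \<longlonglongrightarrow> 0"
proof (rule LIMSEQ_I)
  fix e :: real assume "0 < e"
  obtain g C where cont: "continuous_on UNIV g" and bound: "\<And>x. \<bar>g x\<bar> \<le> C * exp (- norm x)"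
    and g: "integrable lebesgue g" and close: "(\<integral>x. \<bar>w x - g x\<bar> \<partial>lebesgue) < e / 2"
    using continuous_dense_L1[OF w, of "e / 2"] \<open>0 < e\<close> by auto
  have [measurable]: "g \<in> borel_measurable borel" by (rule borel_measurable_continuous_onI[OF cont])
  have ch [measurable]: "character x \<in> borel_measurable borel" for x :: 'a
    unfolding character_def[abs_def] by (intro borel_measurable_continuous_onI continuous_intros)
  have ch' [measurable]: "character x \<in> borel_measurable lebesgue" for x :: 'a
    by (intro measurable_completion) simp
  have int: "integrable lebesgue (\<lambda>\<xi>. of_real (h \<xi>) * character x \<xi>)"
    if h: "integrable lebesgue h" for h :: "'a \<Rightarrow> real" and x
  proof -
    have [measurable]: "h \<in> borel_measurable lebesgue" using h by auto
    show ?thesis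
      by (rule Bochner_Integration.integrable_bound[OF h]) (auto simp: norm_mult norm_character)
  qed
  obtain n0 where n0: "\<And>n. n \<ge> n0 \<Longrightarrow>
      cmod (\<integral>\<xi>. of_real (g \<xi>) * character (X n) \<xi> \<partial>lborel) < e / 2"
    using LIMSEQ_D[OF integral_character_tendsto_0_continuous[OF cont bound X], of "e / 2"]
      \<open>0 < e\<close> by auto
  have "cmod (\<integral>\<xi>. of_real (w \<xi>) * character (X n) \<xi> \<partial>lebesgue) < e" if "n \<ge> n0" for n
  proof -
    have "(\<integral>\<xi>. of_real (w \<xi>) * character (X n) \<xi> \<partial>lebesgue)
        = (\<integral>\<xi>. of_real (w \<xi> - g \<xi>) * character (X n) \<xi> \<partial>lebesgue)
          + (\<integral>\<xi>. of_real (g \<xi>) * character (X n) \<xi> \<partial>lebesgue)"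
      by (subst Bochner_Integration.integral_add[OF int[OF Bochner_Integration.integrable_diff[OF w g]]
            int[OF g], symmetric])
        (intro Bochner_Integration.integral_cong refl, simp add: left_diff_distrib)
    also have "(\<integral>\<xi>. of_real (g \<xi>) * character (X n) \<xi> \<partial>lebesgue)
        = (\<integral>\<xi>. of_real (g \<xi>) * character (X n) \<xi> \<partial>lborel)"
      by (intro integral_completion) measurable
    finally have eq: "(\<integral>\<xi>. of_real (w \<xi>) * character (X n) \<xi> \<partial>lebesgue)
        = (\<integral>\<xi>. of_real (w \<xi> - g \<xi>) * character (X n) \<xi> \<partial>lebesgue)
          + (\<integral>\<xi>. of_real (g \<xi>) * character (X n) \<xi> \<partial>lborel)" .
    have "cmod (\<integral>\<xi>. of_real (w \<xi> - g \<xi>) * character (X n) \<xi> \<partial>lebesgue)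
        \<le> (\<integral>\<xi>. cmod (of_real (w \<xi> - g \<xi>) * character (X n) \<xi>) \<partial>lebesgue)"
      by (rule integral_norm_bound)
    also have "\<dots> < e / 2"
      using close unfolding norm_mult norm_character norm_of_real by simp
    finally show ?thesis
      unfolding eq using n0[OF that] by (intro norm_triangle_lt) auto
  qed
  then show "\<exists>no. \<forall>n\<ge>no. cmod ((\<integral>\<xi>. of_real (w \<xi>) * character (X n) \<xi> \<partial>lebesgue) - 0) < e"
    by auto
qed

section \<open>Composition operators are not compact\<close>

context fourier_composition
begin

text \<open>
  The approximation order \<open>m n\<close> is chosen so large that \<open>a n\<close> behaves like the kernel section of the
  point \<open>p + n v\<close> and \<open>h n\<close> like its image under the adjoint.  Then \<open>a n\<close> is bounded and weakly null,
  while \<open>\<langle>T (h n), a n\<rangle> = \<parallel>h n\<parallel>\<^sup>2\<close> stays away from \<open>0\<close>.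
\<close>

theorem not_compact:
  assumes U: "open U" "U \<noteq> {}" and mass: "0 < dom.mass"
    and vanish: "\<And>X. filterlim X at_infinity sequentially \<Longrightarrow>
      (\<lambda>n. \<integral>\<xi>. character (X n) \<xi> \<partial>M) \<longlonglongrightarrow> 0"
  shows "\<not> compact_operator H ip H' ip' (composition_operator U f)"
proof
  assume compact: "compact_operator H ip H' ip' (composition_operator U f)"
  obtain p \<rho> where p: "0 < \<rho>" "cball p \<rho> \<subseteq> U"
    using U open_contains_cball by blast
  \<comment> \<open>any direction will do; its length keeps the segment inside \<open>U\<close>\<close>
  obtain b :: 'a where b: "norm b = 1" using vector_choose_size[of 1] by auto
  define v where "v = \<rho> *\<^sub>R b"
  have v: "norm v = \<rho>" using p b by (simp add: v_def)
  have segment: "p + s *\<^sub>R v \<in> U" if "0 \<le> s" "s \<le> 1" for s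
  proof -
    have "norm (s *\<^sub>R v) \<le> \<rho>" using that v p by (simp add: mult_left_le_one_le)
    then have "p + s *\<^sub>R v \<in> cball p \<rho>" by (simp add: dist_norm)
    then show ?thesis using p by blast
  qed
  let ?P = "\<lambda>n m. bernstein_comb p v (Suc m) (of_real (real n))"
  have in_U: "snd ` set (?P n m) \<subseteq> U" for n m by (rule points[OF segment])
  have "\<exists>m. (ip_norm ip (target (?P n m)))\<^sup>2 \<in> {dom.mass / 2..2 * dom.mass} \<and>
      (ip_norm ip' (source (?P n m)))\<^sup>2 \<le> 2 * dom.mass + 1 \<and>
      (\<forall>y\<in>U. cmod (source (?P n m) y - (\<integral>\<xi>. character (p - y + real n *\<^sub>R v) \<xi> \<partial>M))
        \<le> 1 / real (Suc n))" for n
  proof -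
    define R where "R = real (Suc n)"
    have R: "\<bar>real n\<bar> \<le> R" "1 \<le> R" by (auto simp: R_def)
    have "(\<lambda>m. Re (energy p v m (of_real (real n)))) \<longlonglongrightarrow> Re (of_real dom.mass)"
      by (intro tendsto_intros energy_limit segment)
    moreover have "Re (energy p v m (of_real (real n))) = (ip_norm ip (target (?P n m)))\<^sup>2" for m
      using energy_real[OF segment, of m "real n"] by (simp only: Re_complex_of_real)
    ultimately have "(\<lambda>m. (ip_norm ip (target (?P n m)))\<^sup>2) \<longlonglongrightarrow> dom.mass"
      by simp
    note lim = this
    have ev: "\<forall>\<^sub>F m in sequentially. dom.mass / 2 < (ip_norm ip (target (?P n m)))\<^sup>2"
        "\<forall>\<^sub>F m in sequentially. (ip_norm ip (target (?P n m)))\<^sup>2 < 2 * dom.mass"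
      by (rule order_tendstoD[OF lim], use mass in simp)+
    have "(\<lambda>m. 32 / (real (Suc m))\<^sup>2 * dom.exp_L1 (8 * pi * R * norm v)) \<longlonglongrightarrow> 0"
         "(\<lambda>m. 4 / real (Suc m) * dom.exp_L1 (4 * pi * R * norm v)) \<longlonglongrightarrow> 0"
      by real_asymp+
    note err = this
    have "\<forall>\<^sub>F m in sequentially. 32 / (real (Suc m))\<^sup>2 * dom.exp_L1 (8 * pi * R * norm v) < 1"
        "\<forall>\<^sub>F m in sequentially. 4 / real (Suc m) * dom.exp_L1 (4 * pi * R * norm v) < 1 / real (Suc n)"
      by (rule order_tendstoD(2)[OF err(1)] order_tendstoD(2)[OF err(2)], simp)+
    with ev have "\<forall>\<^sub>F m in sequentially. (ip_norm ip (target (?P n m)))\<^sup>2 \<in> {dom.mass / 2..2 * dom.mass} \<and>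
      (ip_norm ip' (source (?P n m)))\<^sup>2 \<le> 2 * dom.mass + 1 \<and>
      (\<forall>y\<in>U. cmod (source (?P n m) y - (\<integral>\<xi>. character (p - y + real n *\<^sub>R v) \<xi> \<partial>M))
        \<le> 1 / real (Suc n))"
    proof eventually_elim
      case (elim m)
      show ?case
      proof (intro conjI ballI)
        show "(ip_norm ip (target (?P n m)))\<^sup>2 \<in> {dom.mass / 2..2 * dom.mass}"
          using elim(1,2) by (simp only: atLeastAtMost_iff less_imp_le simp_thms)
        show "(ip_norm ip' (source (?P n m)))\<^sup>2 \<le> 2 * dom.mass + 1"
          using source_norm_le[OF segment R, of m] elim(3) by linarith
        fix y assume "y \<in> U"
        from source_eval_error[OF segment this R, of m] elim(4)
        show "cmod (source (?P n m) y - (\<integral>\<xi>. character (p - y + real n *\<^sub>R v) \<xi> \<partial>M))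
            \<le> 1 / real (Suc n)"
          by linarith
      qed
    qed
    then show ?thesis by (rule eventually_happens'[OF sequentially_bot])
  qed
  then obtain m where m:
      "\<And>n. (ip_norm ip (target (?P n (m n))))\<^sup>2 \<in> {dom.mass / 2..2 * dom.mass}"
      "\<And>n. (ip_norm ip' (source (?P n (m n))))\<^sup>2 \<le> 2 * dom.mass + 1"
      "\<And>n y. y \<in> U \<Longrightarrow> cmod (source (?P n (m n)) y
        - (\<integral>\<xi>. character (p - y + real n *\<^sub>R v) \<xi> \<partial>M)) \<le> 1 / real (Suc n)"
    by metis
  define a where "a n = source (?P n (m n))" for n
  define h where "h n = target (?P n (m n))" for n
  have aH: "a n \<in> H'" and hH: "h n \<in> H" for n
    using source_in[OF in_U] target_in[OF in_U] by (auto simp: a_def h_def)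
  have h_norm: "(ip_norm ip (h n))\<^sup>2 \<in> {dom.mass / 2..2 * dom.mass}" for n
    using m(1) by (simp add: h_def)
  have h_bounded: "ip_norm ip (h n) \<le> sqrt (2 * dom.mass)" for n
    using h_norm[of n] by (intro real_le_rsqrt) simp
  have a_bounded: "ip_norm ip' (a n) \<le> sqrt (2 * dom.mass + 1)" for n
    unfolding a_def using m(2)[of n] by (rule real_le_rsqrt)
  have a_eval: "(\<lambda>n. a n y) \<longlonglongrightarrow> 0" if y: "y \<in> U" for y
  proof -
    let ?k = "\<lambda>n. \<integral>\<xi>. character (p - y + real n *\<^sub>R v) \<xi> \<partial>M"
    have "filterlim (\<lambda>n. p - y + real n *\<^sub>R v) at_infinity sequentially"
    proof (rule tendsto_add_filterlim_at_infinity[OF tendsto_const])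
      have "filterlim (\<lambda>n. real n * \<rho>) at_top sequentially"
        using p by (intro filterlim_at_top_mult_tendsto_pos[OF tendsto_const] filterlim_real_sequentially)
      then show "filterlim (\<lambda>n. real n *\<^sub>R v) at_infinity sequentially"
        by (simp add: filterlim_at_infinity_conv_norm_at_top v)
    qed
    from vanish[OF this] have "?k \<longlonglongrightarrow> 0" .
    moreover have "(\<lambda>n. a n y - ?k n) \<longlonglongrightarrow> 0"
    proof (rule Lim_null_comparison)
      show "\<forall>\<^sub>F n in sequentially. cmod (a n y - ?k n) \<le> 1 / real (Suc n)"
        using m(3)[OF y] by (simp add: a_def)
      show "(\<lambda>n. 1 / real (Suc n)) \<longlonglongrightarrow> 0" by real_asymp
    qed
    ultimately show ?thesis using tendsto_add[of "\<lambda>n. a n y - ?k n" 0 _ ?k 0] by simp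
  qed
  define N where "N = {source qs | qs. snd ` set qs \<subseteq> U}"
  have "(\<lambda>n. ip' g (a n)) \<longlonglongrightarrow> 0" if g: "g \<in> H'" for g
  proof (rule cod.weakly_null_of_subspace[where N = N and K = "sqrt (2 * dom.mass + 1)"])
    show "N \<subseteq> H'" using source_in by (auto simp: N_def)
    show "(\<lambda>x. c x + s * d x) \<in> N" if cd: "c \<in> N" "d \<in> N" for c d s
    proof -
      obtain qs rs where "c = source qs" "d = source rs" "snd ` set qs \<subseteq> U" "snd ` set rs \<subseteq> U"
        using cd by (auto simp: N_def)
      then have "(\<lambda>x. c x + s * d x) = source (qs @ scale_comb s rs)"
          "snd ` set (qs @ scale_comb s rs) \<subseteq> U"
        by (simp_all add: lin_comb_append lin_comb_scale image_Un)
      then show ?thesis unfolding N_def by blast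
    qed
    show "a n \<in> N" for n unfolding a_def N_def using in_U by blast
    show "(\<lambda>n. ip' c (a n)) \<longlonglongrightarrow> 0" if cN: "c \<in> N" for c
    proof -
      obtain qs where c: "c = source qs" and qs: "snd ` set qs \<subseteq> U"
        using cN unfolding N_def by blast
      have "(\<lambda>n. ip' (source qs) (a n)) \<longlonglongrightarrow> 0"
        using qs
      proof (induction qs)
        case Nil
        then show ?case by (simp add: lin_comb_Nil cod.ip_zero_left aH)
      next
        case (Cons q qs)
        obtain d y where q: "q = (d, y)" by fastforce
        have y: "y \<in> U" and qs: "snd ` set qs \<subseteq> U" using Cons.prems by (auto simp: q)
        have "ip' (kernel_section U k y) (a n) = cnj (a n y)" for n
          using cod.ip_commute[OF aH cod.section_in[OF y]] cod.reproducing[OF aH y] by simp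
        then have "ip' (source (q # qs)) (a n) = d * cnj (a n y) + ip' (source qs) (a n)" for n
          using y source_in[OF qs] aH cod.section_in[OF y]
          by (simp add: q lin_comb_Cons cod.ip_add cod.ip_scale cod.scale_closed)
        moreover have "(\<lambda>n. d * cnj (a n y) + ip' (source qs) (a n)) \<longlonglongrightarrow> d * cnj 0 + 0"
          by (intro tendsto_intros a_eval y Cons.IH qs)
        ultimately show ?case by simp
      qed
      then show ?thesis by (simp add: c)
    qed
  qed (use a_bounded g in auto)
  then obtain r where r: "strict_mono r"
      "(\<lambda>n. ip' (composition_operator U f (h (r n))) (a (r n))) \<longlonglongrightarrow> 0"
    using compact_operator_weakly_null_pairing[where h = h and a = a,
        OF dom.function_inner_product_space_axioms cod.function_inner_product_space_axioms
          compact hH h_bounded aH a_bounded]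
    by blast
  have "ip' (composition_operator U f (h (r n))) (a (r n)) = of_real ((ip_norm ip (h (r n)))\<^sup>2)" for n
    using adjoint[OF in_U hH] dom.ip_self[OF hH[of "r n"]] by (simp add: a_def h_def)
  then have "(\<lambda>n. Re (of_real ((ip_norm ip (h (r n)))\<^sup>2))) \<longlonglongrightarrow> Re 0"
    using r(2) by (intro tendsto_intros) simp
  then have "(\<lambda>n. (ip_norm ip (h (r n)))\<^sup>2) \<longlonglongrightarrow> 0" by simp
  then have "dom.mass / 2 \<le> 0"
    by (rule tendsto_lowerbound) (use h_norm in auto)
  then show False using mass by simp
qed

end

text \<open>
  The measure is \<open>w d\<xi>\<close>; its exponential moments exist by (A) applied with rate \<open>|a| + 1\<close>, which
  leaves the integrable majorant \<open>exp (- |\<xi>|)\<close>.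
\<close>

theorem corollary2:
  fixes w :: "real^'d \<Rightarrow> real"
    and k :: "real^'d \<Rightarrow> real^'d \<Rightarrow> complex"
    and U :: "(real^'d) set"
    and f :: "real^'d \<Rightarrow> real^'d"
    and H H\<^sub>U :: "(real^'d \<Rightarrow> complex) set"
    and ip ip\<^sub>U :: "(real^'d \<Rightarrow> complex) \<Rightarrow> (real^'d \<Rightarrow> complex) \<Rightarrow> complex"
  assumes w_L1: "integrable lebesgue w"
    and w_Linf: "\<exists>C. AE \<xi> in lebesgue. \<bar>w \<xi>\<bar> \<le> C"
    and w_nonzero: "\<not> (AE \<xi> in lebesgue. w \<xi> = 0)"
    and w_nonneg: "AE \<xi> in lebesgue. 0 \<le> w \<xi>"
    and k_def: "k = (\<lambda>x y. fourier (\<lambda>\<xi>. complex_of_real (w \<xi>)) (x - y))"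
    and A: "\<forall>a>0. \<exists>c>0. AE \<xi> in lebesgue. w \<xi> \<le> c * exp (- a * norm \<xi>)"
    and B: "\<exists>B>0. \<forall>y.
              limsup (\<lambda>n. ereal (growth_minus n y w)) < ereal B \<and>
              limsup (\<lambda>n. ereal (growth_plus n y w)) < ereal B"
    and C: "span (weight_linear_maps w) = UNIV"
    and RKHS: "rkhs UNIV k H ip"
    and RKHS_U: "rkhs U k H\<^sub>U ip\<^sub>U"
    and U: "open U" "U \<noteq> {}"
    and domain: "composition_domain U f H H\<^sub>U = H"
  shows "\<not> compact_operator H ip H\<^sub>U ip\<^sub>U (composition_operator U f)"
proof
  assume compact: "compact_operator H ip H\<^sub>U ip\<^sub>U (composition_operator U f)"
  interpret D: rkhs UNIV k H ip by (rule RKHS)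
  interpret R: rkhs U k H\<^sub>U ip\<^sub>U by (rule RKHS_U)
  define M where "M = density lebesgue (\<lambda>\<xi>. ennreal (w \<xi>))"
  have wm [measurable]: "w \<in> borel_measurable lebesgue" using w_L1 by auto
  have borel_lebesgue: "g \<in> borel_measurable lebesgue" if "g \<in> borel_measurable borel"
    for g :: "real^'d \<Rightarrow> 'z::topological_space"
    using that by (intro measurable_completion) simp
  have ch: "character x \<in> borel_measurable lebesgue" for x :: "real^'d"
    unfolding character_def[abs_def]
    by (intro borel_lebesgue borel_measurable_continuous_onI continuous_intros)
  have integral_M: "(\<integral>\<xi>. g \<xi> \<partial>M) = (\<integral>\<xi>. w \<xi> *\<^sub>R g \<xi> \<partial>lebesgue)"
    if "g \<in> borel_measurable lebesgue" for g :: "real^'d \<Rightarrow> complex"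
    unfolding M_def using that wm w_nonneg by (rule integral_density)
  have character_M: "(\<integral>\<xi>. character x \<xi> \<partial>M) = (\<integral>\<xi>. of_real (w \<xi>) * character x \<xi> \<partial>lebesgue)" for x
    by (simp add: integral_M[OF ch] scaleR_conv_of_real)
  interpret M: exponential_moments M
  proof
    show "(\<lambda>\<xi>. \<xi>) \<in> borel_measurable M"
      unfolding M_def by (simp add: borel_lebesgue)
    fix a :: real
    have "0 < \<bar>a\<bar> + 1" by simp
    with A obtain c where c: "0 < c" "AE \<xi> in lebesgue. w \<xi> \<le> c * exp (- (\<bar>a\<bar> + 1) * norm \<xi>)"
      by blast
    have em: "(\<lambda>\<xi>. exp (a * norm \<xi>)) \<in> borel_measurable (lebesgue :: (real^'d) measure)"
      by (intro borel_lebesgue borel_measurable_continuous_onI continuous_intros)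
    have "integrable lebesgue (\<lambda>\<xi>::real^'d. c * exp (- norm \<xi>))"
      by (intro integrable_mult_right)
        (simp add: integrable_completion integrable_exp_minus_norm)
    then have "integrable lebesgue (\<lambda>\<xi>. w \<xi> *\<^sub>R exp (a * norm \<xi>))"
    proof (rule Bochner_Integration.integrable_bound)
      show "(\<lambda>\<xi>. w \<xi> *\<^sub>R exp (a * norm \<xi>)) \<in> borel_measurable lebesgue"
        using em by measurable
      show "AE \<xi> in lebesgue. norm (w \<xi> *\<^sub>R exp (a * norm \<xi>)) \<le> norm (c * exp (- norm \<xi>))"
        using c(2) w_nonneg
      proof eventually_elim
        case (elim \<xi>)
        have "w \<xi> * exp (a * norm \<xi>) \<le> c * exp (- (\<bar>a\<bar> + 1) * norm \<xi>) * exp (\<bar>a\<bar> * norm \<xi>)"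
          using elim c(1) by (intro mult_mono) (auto intro!: mult_right_mono)
        also have "\<dots> = c * exp (- norm \<xi>)"
          by (simp add: exp_add[symmetric] algebra_simps)
        finally show ?case using elim c(1) by (simp add: abs_mult)
      qed
    qed
    then show "integrable M (\<lambda>\<xi>. exp (a * norm \<xi>))"
      unfolding M_def using em w_nonneg by (subst integrable_density) auto
  qed
  have kernel: "k x y = (\<integral>\<xi>. character (x - y) \<xi> \<partial>M)" for x y
    unfolding character_M
    by (simp add: k_def fourier_def character_def cis_conv_exp inner_commute mult_ac)
  have scale: "composition_operator U f (\<lambda>x. c * h x) = (\<lambda>x. c * composition_operator U f h x)"
    for c h
    by (simp add: composition_operator_def fun_eq_iff)
  obtain K where K: "0 \<le> K"
      "\<And>h. h \<in> H \<Longrightarrow> ip_norm ip\<^sub>U (composition_operator U f h) \<le> K * ip_norm ip h"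
    using compact_operator_bounded[OF D.function_inner_product_space_axioms
        R.function_inner_product_space_axioms compact scale]
    by blast
  interpret fourier_composition UNIV k H ip M U H\<^sub>U ip\<^sub>U f K
    by unfold_locales
      (use kernel K domain in \<open>auto simp: composition_domain_def\<close>)
  have mass: "0 < M.mass"
  proof -
    have "M.mass = (\<integral>\<xi>. (1::real) \<partial>M)" by (simp add: M.mass_def)
    also have "\<dots> = (\<integral>\<xi>. w \<xi> *\<^sub>R 1 \<partial>lebesgue)"
      unfolding M_def using wm w_nonneg by (intro integral_density) auto
    finally have "M.mass = (\<integral>\<xi>. w \<xi> \<partial>lebesgue)" by simp
    moreover have "0 \<le> (\<integral>\<xi>. w \<xi> \<partial>lebesgue)" using w_nonneg by (rule integral_nonneg_AE)
    moreover have "(\<integral>\<xi>. w \<xi> \<partial>lebesgue) \<noteq> 0"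
      using integral_nonneg_eq_0_iff_AE[OF w_L1 w_nonneg] w_nonzero by simp
    ultimately show ?thesis by simp
  qed
  have "(\<lambda>n. \<integral>\<xi>. character (X n) \<xi> \<partial>M) \<longlonglongrightarrow> 0" if "filterlim X at_infinity sequentially" for X
    unfolding character_M by (rule Riemann_Lebesgue[OF w_L1 that])
  from not_compact[OF U mass this] compact show False by blast
qed

end
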